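(* Let $W_1,W_2,W_3$ be generalized modules for a Möbius (or conformal) vertex algebra $V$, let $\mathcal{Y}$ be a logarithmic intertwining operator of type $\binom{W_3}{W_1\,W_2}$, and let $r\in\mathbb{Z}$. Define $\Omega_r(\mathcal{Y}):W_2\otimes W_1\to W_3[\log x]\{x\}$ by $$\Omega_r(\mathcal{Y})(w_{(2)},x)w_{(1)}=e^{xL(-1)}\mathcal{Y}(w_{(1)},e^{(2r+1)\pi i}x)w_{(2)}$$ for $w_{(1)}\in W_1$ and $w_{(2)}\in W_2$. Then $\Omega_r(\mathcal{Y})$ is a logarithmic intertwining operator of type $\binom{W_3}{W_2\,W_1}$. Moreover, $$\Omega_{-r-1}(\Omega_r(\mathcal{Y}))=\Omega_r(\Omega_{-r-1}(\mathcal{Y}))=\mathcal{Y}.$$ In the strongly graded case (i.e. when $V,W_1,W_2,W_3$ are strongly graded), if $\mathcal{Y}$ is grading-compatible, then so is $\Omega_r(\mathcal{Y})$, and in particular the correspondence $\mathcal{Y}\mapsto\Omega_r(\mathcal{Y})$ defines a linear isomorphism from $\mathcal{V}^{W_3}_{W_1\,W_2}$ to $\mathcal{V}^{W_3}_{W_2\,W_1}$, and $$N^{W_3}_{W_1\,W_2}=N^{W_3}_{W_2\,W_1}.$$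
   Context: All vector spaces are over $\mathbb{C}$; $\mathbb{N}=\{0,1,2,\dots\}$. Formal variables: $\log x$ is a formal variable independent of $x$; $\mathcal{W}[\log x]\{x\}$ is the space of formal series $\sum_{n\in\mathbb{C}}p_nx^n$ with $p_n\in\mathcal{W}[\log x]$; $\frac{d}{dx}$ acts by $\frac{d}{dx}x^n(\log x)^k=nx^{n-1}(\log x)^k+kx^{n-1}(\log x)^{k-1}$, extended to formal sums. $\delta(x)=\sum_{n\in\mathbb{Z}}x^n$, and powers of binomials are expanded in nonnegative integral powers of the second term. Conformal vertex algebra: a $\mathbb{Z}$-graded space $V=\bigoplus_{n\in\mathbb{Z}}V_{(n)}$ with a linear map $V\otimes V\to V[[x,x^{-1}]]$, $u\otimes v\mapsto Y(u,x)v=\sum_{n\in\mathbb{Z}}u_nv\,x^{-n-1}$, a vacuum $\mathbf{1}\in V_{(0)}$ and a conformal vector $\omega\in V_{(2)}$, such that: $u_nv=0$ for $n$ sufficiently large; $Y(\mathbf{1},x)=1$; $Y(v,x)\mathbf{1}\in V[[x]]$ with constant term $v$; the Jacobi identity holds; the operators $L(n)$ given by $Y(\omega,x)=\sum_nL(n)x^{-n-2}$ satisfy the Virasoro relations (for some central charge); $L(0)v=nv$ for $v\in V_{(n)}$; $Y(L(-1)v,x)=\frac{d}{dx}Y(v,x)$. No finiteness or lower-boundedness of the grading is assumed. Möbius vertex algebra: the same, except that instead of $\omega$ one has operators $L(-1),L(0),L(1)$ on $V$ giving a representation of $\mathfrak{sl}(2)$ ($[L(0),L(\pm1)]=\mp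 L(\pm1)$, $[L(1),L(-1)]=2L(0)$) with $[L(j),Y(v,x)]=\sum_{i=0}^{j+1}\binom{j+1}{i}x^iY(L(j-i)v,x)$ for $j=-1,0,1$, together with the $L(0)$-grading and $L(-1)$-derivative properties. Generalized $V$-module: a $\mathbb{C}$-graded space $W=\bigoplus_{n\in\mathbb{C}}W_{[n]}$ with a linear map $V\otimes W\to W[[x,x^{-1}]]$, $v\otimes w\mapsto Y_W(v,x)w=\sum_nv_nw\,x^{-n-1}$ (and, in the Möbius case, an $\mathfrak{sl}(2)$-action by $L(-1),L(0),L(1)$ on $W$; in the conformal case $L(n)$ comes from $Y_W(\omega,x)$), satisfying all the axioms above that make sense (lower truncation, $Y_W(\mathbf{1},x)=1$, Jacobi identity, Virasoro relations resp. $\mathfrak{sl}(2)$-bracket relations, $L(-1)$-derivative property), except that the $L(0)$-grading property is: for $w\in W_{[n]}$, $(L(0)-n)^Nw=0$ for $N$ sufficiently large (depending on $w$). Logarithmic intertwining operator of type $\binom{W_3}{W_1\,W_2}$ (for generalized modules $(W_i,Y_i)$): a linear map $\mathcal{Y}(\cdot,x)\cdot:W_1\otimes W_2\to W_3[\log x]\{x\}$, $$\mathcal{Y}(w_{(1)},x)w_{(2)}=\sum_{n\in\mathbb{C}}\sum_{k\in\mathbb{N}}{w_{(1)}}^{\mathcal{Y}}_{n;\,k}w_{(2)}\,x^{-n-1}(\log x)^k,$$ such that: (lower truncation) for all $w_{(1)},w_{(2)}$ and $n\in\mathbb{C}$, ${w_{(1)}}^{\mathcal{Y}}_{n+m;\,k}w_{(2)}=0$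 for $m\in\mathbb{N}$ sufficiently large, independently of $k$; (Jacobi identity) for $v\in V$, $$x_0^{-1}\delta\Big(\tfrac{x_1-x_2}{x_0}\Big)Y_3(v,x_1)\mathcal{Y}(w_{(1)},x_2)w_{(2)}-x_0^{-1}\delta\Big(\tfrac{x_2-x_1}{-x_0}\Big)\mathcal{Y}(w_{(1)},x_2)Y_2(v,x_1)w_{(2)}=x_2^{-1}\delta\Big(\tfrac{x_1-x_0}{x_2}\Big)\mathcal{Y}(Y_1(v,x_0)w_{(1)},x_2)w_{(2)};$$ ($L(-1)$-derivative property) $\mathcal{Y}(L(-1)w_{(1)},x)=\frac{d}{dx}\mathcal{Y}(w_{(1)},x)$; and ($\mathfrak{sl}(2)$-bracket relations) $[L(j),\mathcal{Y}(w_{(1)},x)]=\sum_{i=0}^{j+1}\binom{j+1}{i}x^i\mathcal{Y}(L(j-i)w_{(1)},x)$ for $j=-1,0,1$. Substitution: for $\zeta\in\mathbb{C}$, $\mathcal{Y}(w_{(1)},e^\zeta x)w_{(2)}$ denotes the element of $W_3[\log x]\{x\}$ obtained from $\mathcal{Y}(w_{(1)},y)w_{(2)}$ by replacing $y^n$ by $e^{\zeta n}x^n$ and $(\log y)^k$ by $(\zeta+\log x)^k$ for all $n\in\mathbb{C}$, $k\in\mathbb{N}$ (it depends on $\zeta$, not just on $e^\zeta$); here $\zeta=(2r+1)\pi i$. Strong gradedness: let $A$ be an abelian subgroup of an abelian group $\tilde A$. $V$ is strongly graded (with respect to $A$) if it has a second grading $V=\bigoplus_{\alpha\in A}V^{(\alpha)}$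 compatible with the first ($V^{(\alpha)}=\bigoplus_nV^{(\alpha)}_{(n)}$, $V^{(\alpha)}_{(n)}=V^{(\alpha)}\cap V_{(n)}$) such that for $\alpha,\beta\in A$: $V^{(\alpha)}_{(n)}=0$ for $n$ sufficiently negative; $\dim V^{(\alpha)}_{(n)}<\infty$; $\mathbf{1}\in V^{(0)}_{(0)}$; $v_lV^{(\beta)}\subset V^{(\alpha+\beta)}$ for $v\in V^{(\alpha)}$, $l\in\mathbb{Z}$; and $L(j)V^{(\alpha)}\subset V^{(\alpha)}$ for $j=0,\pm1$ (in the conformal case $\omega\in V^{(0)}_{(2)}$). A generalized module $W$ is strongly graded (with respect to $\tilde A$) if it has a compatible second grading $W=\bigoplus_{\beta\in\tilde A}W^{(\beta)}$, with $W^{(\beta)}_{[n]}=W^{(\beta)}\cap W_{[n]}$, such that for $\alpha\in A,\beta\in\tilde A,n\in\mathbb{C}$: $W^{(\beta)}_{[n+k]}=0$ for $k\in\mathbb{Z}$ sufficiently negative; $\dim W^{(\beta)}_{[n]}<\infty$; $v_lW^{(\beta)}\subset W^{(\alpha+\beta)}$ for $v\in V^{(\alpha)}$, $l\in\mathbb{Z}$; $L(j)W^{(\beta)}\subset W^{(\beta)}$ for $j=0,\pm1$. When $V,W_1,W_2,W_3$ are strongly graded (same $A,\tilde A$), a logarithmic intertwining operator $\mathcal{Y}$ is grading-compatible if ${w_{(1)}}^{\mathcal{Y}}_{n;\,k}w_{(2)}\in W_3^{(\beta+\gamma)}$ for all $\beta,\gamma\in\tilde A$, $w_{(1)}\in W_1^{(\beta)}$,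 $w_{(2)}\in W_2^{(\gamma)}$, $n\in\mathbb{C}$, $k\in\mathbb{N}$. $\mathcal{V}^{W_3}_{W_1\,W_2}$ is the vector space of grading-compatible logarithmic intertwining operators of type $\binom{W_3}{W_1\,W_2}$, and $N^{W_3}_{W_1\,W_2}=\dim\mathcal{V}^{W_3}_{W_1\,W_2}$ (the fusion rule). *)

theory Defs
  imports Complex_Main "HOL-Library.Function_Algebras" "HOL-Library.Groups_Big_Fun"
begin

section \<open>Linear algebra\<close>

text \<open>
  A complex vector space is a type of class \<open>ab_group_add\<close> with a scalar multiplication \<open>s\<close>
  satisfying the library predicate \<^term>\<open>vector_space s\<close>. \<open>direct_sum s X I G\<close> says that the
  subspace \<open>X\<close> is the internal direct sum of the subspaces \<open>G i\<close>, \<open>i \<in> I\<close>.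
\<close>

definition direct_sum ::
  "(complex \<Rightarrow> 'w::ab_group_add \<Rightarrow> 'w) \<Rightarrow> 'w set \<Rightarrow> 'i set \<Rightarrow> ('i \<Rightarrow> 'w set) \<Rightarrow> bool" where
  "direct_sum s X I G \<longleftrightarrow>
     module.subspace s X \<and>
     (\<forall>i\<in>I. module.subspace s (G i) \<and> G i \<subseteq> X) \<and>
     (\<forall>w\<in>X. \<exists>!f. (\<forall>i\<in>I. f i \<in> G i) \<and> (\<forall>i. i \<notin> I \<longrightarrow> f i = 0) \<and>
                 finite {i. f i \<noteq> 0} \<and> w = Sum_any f)"

definition finite_dim :: "(complex \<Rightarrow> 'w::ab_group_add \<Rightarrow> 'w) \<Rightarrow> 'w set \<Rightarrow> bool" where
  "finite_dim s X \<longleftrightarrow> (\<exists>B. finite B \<and> module.span s B = X)"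

text \<open>
  The dimension as a cardinal number, i.e. the cardinality of a basis. The library's
  \<^const>\<open>vector_space.dim\<close> is a natural number, equal to 0 for infinite-dimensional spaces.
\<close>

definition card_dim :: "(complex \<Rightarrow> 'w::ab_group_add \<Rightarrow> 'w) \<Rightarrow> 'w set \<Rightarrow> 'w rel" where
  "card_dim s X = card_of (SOME B. \<not> module.dependent s B \<and> module.span s B = X)"

definition linear_iso_on ::
  "(complex \<Rightarrow> 'a::ab_group_add \<Rightarrow> 'a) \<Rightarrow> (complex \<Rightarrow> 'b::ab_group_add \<Rightarrow> 'b) \<Rightarrow>
   'a set \<Rightarrow> 'b set \<Rightarrow> ('a \<Rightarrow> 'b) \<Rightarrow> bool" where
  "linear_iso_on s t X X' f \<longleftrightarrow>
     module.subspace s X \<and> module.subspace t X' \<and>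
     (\<forall>x\<in>X. \<forall>y\<in>X. f (x + y) = f x + f y) \<and>
     (\<forall>c. \<forall>x\<in>X. f (s c x) = t c (f x)) \<and>
     bij_betw f X X'"

definition add_subgroup :: "'g::ab_group_add set \<Rightarrow> bool" where
  "add_subgroup A \<longleftrightarrow> 0 \<in> A \<and> (\<forall>a\<in>A. \<forall>b\<in>A. a + b \<in> A) \<and> (\<forall>a\<in>A. - a \<in> A)"


section \<open>Formal series\<close>

text \<open>
  Series are given by their coefficient functions: \<open>f :: int \<Rightarrow> 'w\<close> stands for the element
  \<open>\<Sum>n. f n x\<^sup>n\<close> of \<open>W[[x,x\<inverse>]]\<close>, and \<open>f :: complex \<Rightarrow> nat \<Rightarrow> 'w\<close> for
  \<open>\<Sum>n k. f n k x\<^sup>n (log x)\<^sup>k\<close>, which is in \<open>W[log x]{x}\<close> iff \<open>log_series f\<close>.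
  Infinite sums of vectors are taken with \<^const>\<open>Sum_any\<close>, the sum of a finitely
  supported family; wherever these are used below, the truncation conditions guarantee finite
  support.
\<close>

type_synonym 'w log_ser = "complex \<Rightarrow> nat \<Rightarrow> 'w"

definition log_series :: "'w::zero log_ser \<Rightarrow> bool" where
  "log_series f \<longleftrightarrow> (\<forall>n. finite {k. f n k \<noteq> 0})"

text \<open>The coefficient of \<open>x\<^sup>-\<^sup>n\<^sup>-\<^sup>1\<close>, for integral or complex exponents.\<close>

definition mode :: "('e::ring_1 \<Rightarrow> 'a) \<Rightarrow> 'e \<Rightarrow> 'a" where
  "mode f n = f (- n - 1)"

definition ddx :: "(complex \<Rightarrow> 'w \<Rightarrow> 'w) \<Rightarrow> (int \<Rightarrow> 'w) \<Rightarrow> int \<Rightarrow> 'w" where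
  "ddx s f n = s (of_int (n + 1)) (f (n + 1))"

definition ddx_log :: "(complex \<Rightarrow> 'w::plus \<Rightarrow> 'w) \<Rightarrow> 'w log_ser \<Rightarrow> 'w log_ser" where
  "ddx_log s f n k = s (n + 1) (f (n + 1) k) + s (of_nat (k + 1)) (f (n + 1) (k + 1))"

text \<open>Replace \<open>x\<^sup>n\<close> by \<open>exp (\<zeta> n) x\<^sup>n\<close> and \<open>(log x)\<^sup>j\<close> by \<open>(\<zeta> + log x)\<^sup>j\<close>.\<close>

definition subst_exp ::
  "(complex \<Rightarrow> 'w::ab_group_add \<Rightarrow> 'w) \<Rightarrow> complex \<Rightarrow> 'w log_ser \<Rightarrow> 'w log_ser" where
  "subst_exp s \<zeta> f n k =
     Sum_any (\<lambda>j. s (exp (\<zeta> * n) * of_nat (j choose k) * \<zeta> ^ (j - k)) (f n j))"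

text \<open>The series \<open>e\<^bsup>x D\<^esup> f(x)\<close> for an operator \<open>D\<close>.\<close>

definition exp_xD ::
  "(complex \<Rightarrow> 'w::ab_group_add \<Rightarrow> 'w) \<Rightarrow> ('w \<Rightarrow> 'w) \<Rightarrow> 'w log_ser \<Rightarrow> 'w log_ser" where
  "exp_xD s D f n k = Sum_any (\<lambda>i::nat. s (1 / fact i) ((D ^^ i) (f (n - of_nat i) k)))"

text \<open>
  \<open>binom_diff n p q\<close> is the coefficient of \<open>y\<^sup>p z\<^sup>q\<close> in \<open>(y - z)\<^sup>n\<close>, expanded in nonnegative
  powers of \<open>z\<close>. The next three functions give the coefficient of \<open>x\<^sub>0\<^sup>a x\<^sub>1\<^sup>b x\<^sub>2\<^sup>c\<close> in
  \<open>x\<^sub>0\<inverse> \<delta>((x\<^sub>1 - x\<^sub>2)/x\<^sub>0)\<close>, \<open>x\<^sub>0\<inverse> \<delta>((x\<^sub>2 - x\<^sub>1)/(-x\<^sub>0))\<close> and \<open>x\<^sub>2\<inverse> \<delta>((x\<^sub>1 - x\<^sub>0)/x\<^sub>2)\<close>,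
  where \<open>\<delta>(x) = \<Sum>n\<in>\<int>. x\<^sup>n\<close>: the exponent of the denominator determines the summation index.
\<close>

definition binom_diff :: "int \<Rightarrow> int \<Rightarrow> int \<Rightarrow> complex" where
  "binom_diff n p q =
     (if 0 \<le> q \<and> p + q = n then (of_int n gchoose nat q) * (- 1) ^ nat q else 0)"

definition delta_12_0 :: "int \<Rightarrow> int \<Rightarrow> int \<Rightarrow> complex" where
  "delta_12_0 a b c = binom_diff (- a - 1) b c"

definition delta_21_0 :: "int \<Rightarrow> int \<Rightarrow> int \<Rightarrow> complex" where
  "delta_21_0 a b c = (- 1) powi (a + 1) * binom_diff (- a - 1) c b"

definition delta_10_2 :: "int \<Rightarrow> int \<Rightarrow> int \<Rightarrow> complex" where
  "delta_10_2 a b c = binom_diff (- c - 1) b a"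

text \<open>
  The product of a scalar series with integral exponents and a vector-valued series in
  \<open>x\<^sub>0, x\<^sub>1, x\<^sub>2\<close>; the exponents of \<open>x\<^sub>2\<close> in the latter may be integers or complex numbers.
\<close>

definition ser_mult ::
  "(complex \<Rightarrow> 'w::ab_group_add \<Rightarrow> 'w) \<Rightarrow> (int \<Rightarrow> int \<Rightarrow> int \<Rightarrow> complex) \<Rightarrow>
   (int \<Rightarrow> int \<Rightarrow> 'e::ring_1 \<Rightarrow> 'w) \<Rightarrow> int \<Rightarrow> int \<Rightarrow> 'e \<Rightarrow> 'w" where
  "ser_mult s d F a b c =
     Sum_any (\<lambda>(a', b', c'). s (d a' b' c') (F (a - a') (b - b') (c - of_int c')))"

text \<open>
  The conditions below are for a series-valued bilinear map \<open>I\<close>, which is a vertex operator map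
  (\<open>'e = int\<close>) or the coefficient of a fixed power of \<open>log x\<close> in an intertwining operator
  (\<open>'e = complex\<close>).
\<close>

definition jacobi_identity ::
  "(complex \<Rightarrow> 'w3::ab_group_add \<Rightarrow> 'w3) \<Rightarrow>
   ('v \<Rightarrow> 'w1 \<Rightarrow> int \<Rightarrow> 'w1::zero) \<Rightarrow> ('v \<Rightarrow> 'w2 \<Rightarrow> int \<Rightarrow> 'w2) \<Rightarrow> ('v \<Rightarrow> 'w3 \<Rightarrow> int \<Rightarrow> 'w3) \<Rightarrow>
   ('w1 \<Rightarrow> 'w2 \<Rightarrow> 'e::ring_1 \<Rightarrow> 'w3) \<Rightarrow> bool" where
  "jacobi_identity s Y1 Y2 Y3 I \<longleftrightarrow>
     (\<forall>v w1 w2 a b c.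
        ser_mult s delta_12_0 (\<lambda>a b c. if a = 0 then Y3 v (I w1 w2 c) b else 0) a b c
      - ser_mult s delta_21_0 (\<lambda>a b c. if a = 0 then I w1 (Y2 v w2 b) c else 0) a b c
      = ser_mult s delta_10_2 (\<lambda>a b c. if b = 0 then I (Y1 v w1 a) w2 c else 0) a b c)"

text \<open>\<open>[L(j), I(w\<^sub>1,x)] = \<Sum>i\<le>j+1. (j+1 choose i) x\<^sup>i I(L(j-i) w\<^sub>1, x)\<close> for \<open>j = -1, 0, 1\<close>\<close>

definition sl2_bracket ::
  "(complex \<Rightarrow> 'w3::ab_group_add \<Rightarrow> 'w3) \<Rightarrow>
   (int \<Rightarrow> 'w1 \<Rightarrow> 'w1) \<Rightarrow> (int \<Rightarrow> 'w2 \<Rightarrow> 'w2) \<Rightarrow> (int \<Rightarrow> 'w3 \<Rightarrow> 'w3) \<Rightarrow>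
   ('w1 \<Rightarrow> 'w2 \<Rightarrow> 'e::ring_1 \<Rightarrow> 'w3) \<Rightarrow> bool" where
  "sl2_bracket s L1 L2 L3 I \<longleftrightarrow>
     (\<forall>j\<in>{-1, 0, 1}. \<forall>w1 w2 n.
        L3 j (I w1 w2 n) - I w1 (L2 j w2) n =
        (\<Sum>i = 0..nat (j + 1). s (of_nat (nat (j + 1) choose i))
                                 (I (L1 (j - int i) w1) w2 (n - of_nat i))))"

definition bilinear_ser ::
  "(complex \<Rightarrow> 'w1::ab_group_add \<Rightarrow> 'w1) \<Rightarrow> (complex \<Rightarrow> 'w2::ab_group_add \<Rightarrow> 'w2) \<Rightarrow>
   (complex \<Rightarrow> 'w3::ab_group_add \<Rightarrow> 'w3) \<Rightarrow> ('w1 \<Rightarrow> 'w2 \<Rightarrow> 'e \<Rightarrow> 'w3) \<Rightarrow> bool" where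
  "bilinear_ser s1 s2 s3 I \<longleftrightarrow>
     (\<forall>n. (\<forall>w2. Vector_Spaces.linear s1 s3 (\<lambda>w1. I w1 w2 n)) \<and>
          (\<forall>w1. Vector_Spaces.linear s2 s3 (\<lambda>w2. I w1 w2 n)))"

definition sl2_action :: "(complex \<Rightarrow> 'w::ab_group_add \<Rightarrow> 'w) \<Rightarrow> (int \<Rightarrow> 'w \<Rightarrow> 'w) \<Rightarrow> bool" where
  "sl2_action s L \<longleftrightarrow>
     (\<forall>j\<in>{-1, 0, 1}. Vector_Spaces.linear s s (L j)) \<and>
     (\<forall>w. L 0 (L 1 w) - L 1 (L 0 w) = - L 1 w) \<and>
     (\<forall>w. L 0 (L (-1) w) - L (-1) (L 0 w) = L (-1) w) \<and>
     (\<forall>w. L 1 (L (-1) w) - L (-1) (L 1 w) = s 2 (L 0 w))"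

definition virasoro_relations ::
  "(complex \<Rightarrow> 'w::ab_group_add \<Rightarrow> 'w) \<Rightarrow> complex \<Rightarrow> (int \<Rightarrow> 'w \<Rightarrow> 'w) \<Rightarrow> bool" where
  "virasoro_relations s c L \<longleftrightarrow>
     (\<forall>m n w. L m (L n w) - L n (L m w) =
        s (of_int (m - n)) (L (m + n) w) +
        s (if m + n = 0 then of_int (m ^ 3 - m) / 12 * c else 0) w)"


section \<open>Vertex algebras and generalized modules\<close>

text \<open>
  \<open>Conformal \<omega> c\<close> records the conformal vector and the central charge. In the Moebius case only
  \<open>L (-1)\<close>, \<open>L 0\<close>, \<open>L 1\<close> are meaningful; the other values of the fields \<open>vL\<close> and \<open>mL\<close> are never
  used. In the conformal case all \<open>L n\<close> are required to be the modes of the vertex operator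
  of \<open>\<omega>\<close>.
\<close>

datatype 'v va_kind = Moebius | Conformal 'v complex

record 'v va =
  vkind :: "'v va_kind"
  vscale :: "complex \<Rightarrow> 'v \<Rightarrow> 'v"
  vgrade :: "int \<Rightarrow> 'v set"
  vY :: "'v \<Rightarrow> 'v \<Rightarrow> int \<Rightarrow> 'v"
  vac :: 'v
  vL :: "int \<Rightarrow> 'v \<Rightarrow> 'v"

record ('v, 'w) gmod =
  mscale :: "complex \<Rightarrow> 'w \<Rightarrow> 'w"
  mgrade :: "complex \<Rightarrow> 'w set"
  mY :: "'v \<Rightarrow> 'w \<Rightarrow> int \<Rightarrow> 'w"
  mL :: "int \<Rightarrow> 'w \<Rightarrow> 'w"

text \<open>The axioms shared by the adjoint action (\<open>YW = vY V\<close>) and the action on a module.\<close>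

locale vertex_action =
  fixes V :: "'v::ab_group_add va"
    and s :: "complex \<Rightarrow> 'w::ab_group_add \<Rightarrow> 'w"
    and YW :: "'v \<Rightarrow> 'w \<Rightarrow> int \<Rightarrow> 'w"
  assumes Y_bilinear: "bilinear_ser (vscale V) s s YW"
    and Y_truncation: "\<exists>N. \<forall>n\<ge>N. mode (YW v w) n = 0"
    and Y_vacuum: "YW (vac V) w n = (if n = 0 then w else 0)"
    and Y_jacobi: "jacobi_identity s (vY V) YW YW YW"
    and Y_derivative: "YW (vL V (-1) v) w = ddx s (YW v w)"

locale vertex_algebra_axioms =
  vertex_action V "vscale V" "vY V" for V :: "'v::ab_group_add va" +
  assumes vector_space: "vector_space (vscale V)"
    and grading: "direct_sum (vscale V) UNIV UNIV (vgrade V)"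
    and vacuum_grade: "vac V \<in> vgrade V 0"
    and creation: "n < 0 \<Longrightarrow> vY V v (vac V) n = 0" "vY V v (vac V) 0 = v"
    and L0_grading: "v \<in> vgrade V m \<Longrightarrow> vL V 0 v = vscale V (of_int m) v"

locale moebius_vertex_algebra = vertex_algebra_axioms V for V :: "'v::ab_group_add va" +
  assumes sl2: "sl2_action (vscale V) (vL V)"
    and bracket: "sl2_bracket (vscale V) (vL V) (vL V) (vL V) (vY V)"

locale conformal_vertex_algebra = vertex_algebra_axioms V for V :: "'v::ab_group_add va" +
  fixes \<omega> :: 'v and c :: complex
  assumes conformal_grade: "\<omega> \<in> vgrade V 2"
    and L_def: "vL V n v = vY V \<omega> v (- n - 2)"
    and virasoro: "virasoro_relations (vscale V) c (vL V)"

definition vertex_algebra :: "'v::ab_group_add va \<Rightarrow> bool" where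
  "vertex_algebra V \<longleftrightarrow>
     (case vkind V of
        Moebius \<Rightarrow> moebius_vertex_algebra V
      | Conformal \<omega> c \<Rightarrow> conformal_vertex_algebra V \<omega> c)"

locale generalized_module_axioms =
  vertex_action V "mscale W" "mY W"
  for V :: "'v::ab_group_add va" and W :: "('v, 'w::ab_group_add) gmod" +
  assumes vector_space: "vector_space (mscale W)"
    and grading: "direct_sum (mscale W) UNIV UNIV (mgrade W)"
    and L0_grading: "w \<in> mgrade W n \<Longrightarrow>
          \<exists>K. \<forall>N\<ge>K. ((\<lambda>u. mL W 0 u - mscale W n u) ^^ N) w = 0"

locale moebius_generalized_module = generalized_module_axioms V W
  for V :: "'v::ab_group_add va" and W :: "('v, 'w::ab_group_add) gmod" +
  assumes sl2: "sl2_action (mscale W) (mL W)"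
    and bracket: "sl2_bracket (mscale W) (vL V) (mL W) (mL W) (mY W)"

locale conformal_generalized_module = generalized_module_axioms V W
  for V :: "'v::ab_group_add va" and W :: "('v, 'w::ab_group_add) gmod" +
  fixes \<omega> :: 'v and c :: complex
  assumes L_def: "mL W n w = mY W \<omega> w (- n - 2)"
    and virasoro: "virasoro_relations (mscale W) c (mL W)"

definition generalized_module ::
  "'v::ab_group_add va \<Rightarrow> ('v, 'w::ab_group_add) gmod \<Rightarrow> bool" where
  "generalized_module V W \<longleftrightarrow>
     (case vkind V of
        Moebius \<Rightarrow> moebius_generalized_module V W
      | Conformal \<omega> c \<Rightarrow> conformal_generalized_module V W \<omega> c)"


section \<open>Logarithmic intertwining operators\<close>

type_synonym ('w1, 'w2, 'w3) log_op = "'w1 \<Rightarrow> 'w2 \<Rightarrow> 'w3 log_ser"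

text \<open>
  The vertex algebra is not a parameter: its elements are those of the type \<open>'v\<close>, and it enters
  the axioms only through the module actions.
\<close>

locale log_intertwining_operator =
  fixes W1 :: "('v, 'w1::ab_group_add) gmod"
    and W2 :: "('v, 'w2::ab_group_add) gmod"
    and W3 :: "('v, 'w3::ab_group_add) gmod"
    and I :: "('w1, 'w2, 'w3) log_op"
  assumes log_series: "log_series (I w1 w2)"
    and bilinear: "bilinear_ser (mscale W1) (mscale W2) (mscale W3) (\<lambda>w1 w2 n. I w1 w2 n k)"
    and truncation: "\<exists>M::nat. \<forall>m\<ge>M. \<forall>k. mode (I w1 w2) (n + of_nat m) k = 0"
    and jacobi: "jacobi_identity (mscale W3) (mY W1) (mY W2) (mY W3) (\<lambda>w1 w2 n. I w1 w2 n k)"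
    and derivative: "I (mL W1 (-1) w1) w2 = ddx_log (mscale W3) (I w1 w2)"
    and bracket: "sl2_bracket (mscale W3) (mL W1) (mL W2) (mL W3) (\<lambda>w1 w2 n. I w1 w2 n k)"

definition Omega ::
  "('v, 'w3::ab_group_add) gmod \<Rightarrow> int \<Rightarrow> ('w1, 'w2, 'w3) log_op \<Rightarrow> ('w2, 'w1, 'w3) log_op" where
  "Omega W3 r I w2 w1 =
     exp_xD (mscale W3) (mL W3 (-1))
       (subst_exp (mscale W3) (of_int (2 * r + 1) * of_real pi * \<i>) (I w1 w2))"


section \<open>Strong gradedness\<close>

locale strongly_graded_algebra =
  fixes V :: "'v::ab_group_add va"
    and A :: "'g::ab_group_add set"
    and G :: "'g \<Rightarrow> 'v set"
  assumes decomposition: "direct_sum (vscale V) UNIV A G"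
    and compatible: "\<alpha> \<in> A \<Longrightarrow> direct_sum (vscale V) (G \<alpha>) UNIV (\<lambda>n. G \<alpha> \<inter> vgrade V n)"
    and lower_bounded: "\<alpha> \<in> A \<Longrightarrow> \<exists>N. \<forall>n\<le>N. G \<alpha> \<inter> vgrade V n = {0}"
    and finite_dim: "\<alpha> \<in> A \<Longrightarrow> finite_dim (vscale V) (G \<alpha> \<inter> vgrade V n)"
    and vacuum: "vac V \<in> G 0 \<inter> vgrade V 0"
    and modes: "\<lbrakk>\<alpha> \<in> A; \<beta> \<in> A; v \<in> G \<alpha>; u \<in> G \<beta>\<rbrakk> \<Longrightarrow> mode (vY V v u) l \<in> G (\<alpha> + \<beta>)"
    and sl2: "\<lbrakk>\<alpha> \<in> A; j \<in> {-1, 0, 1}; v \<in> G \<alpha>\<rbrakk> \<Longrightarrow> vL V j v \<in> G \<alpha>"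
    and conformal: "vkind V = Conformal \<omega> c \<Longrightarrow> \<omega> \<in> G 0 \<inter> vgrade V 2"

locale strongly_graded_module =
  fixes A :: "'g::ab_group_add set"
    and G :: "'g \<Rightarrow> 'v set"
    and W :: "('v, 'w::ab_group_add) gmod"
    and H :: "'g \<Rightarrow> 'w set"
  assumes decomposition: "direct_sum (mscale W) UNIV UNIV H"
    and compatible: "direct_sum (mscale W) (H \<beta>) UNIV (\<lambda>n. H \<beta> \<inter> mgrade W n)"
    and lower_bounded: "\<exists>K::int. \<forall>k\<le>K. H \<beta> \<inter> mgrade W (n + of_int k) = {0}"
    and finite_dim: "finite_dim (mscale W) (H \<beta> \<inter> mgrade W n)"
    and modes: "\<lbrakk>\<alpha> \<in> A; v \<in> G \<alpha>; w \<in> H \<beta>\<rbrakk> \<Longrightarrow> mode (mY W v w) l \<in> H (\<alpha> + \<beta>)"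
    and sl2: "\<lbrakk>j \<in> {-1, 0, 1}; w \<in> H \<beta>\<rbrakk> \<Longrightarrow> mL W j w \<in> H \<beta>"

definition grading_compatible ::
  "('g::ab_group_add \<Rightarrow> 'w1 set) \<Rightarrow> ('g \<Rightarrow> 'w2 set) \<Rightarrow> ('g \<Rightarrow> 'w3 set) \<Rightarrow>
   ('w1, 'w2, 'w3) log_op \<Rightarrow> bool" where
  "grading_compatible H1 H2 H3 I \<longleftrightarrow>
     (\<forall>\<beta> \<gamma>. \<forall>w1\<in>H1 \<beta>. \<forall>w2\<in>H2 \<gamma>. \<forall>n k. mode (I w1 w2) n k \<in> H3 (\<beta> + \<gamma>))"

definition intertwining_space ::
  "('v, 'w1::ab_group_add) gmod \<Rightarrow> ('v, 'w2::ab_group_add) gmod \<Rightarrow>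
   ('v, 'w3::ab_group_add) gmod \<Rightarrow>
   ('g::ab_group_add \<Rightarrow> 'w1 set) \<Rightarrow> ('g \<Rightarrow> 'w2 set) \<Rightarrow> ('g \<Rightarrow> 'w3 set) \<Rightarrow>
   ('w1, 'w2, 'w3) log_op set" where
  "intertwining_space W1 W2 W3 H1 H2 H3 =
     {I. log_intertwining_operator W1 W2 W3 I \<and> grading_compatible H1 H2 H3 I}"

text \<open>
  The vector space structure on operators is pointwise; addition and zero are those of
  \<^theory>\<open>HOL-Library.Function_Algebras\<close>.
\<close>

definition op_scale ::
  "('v, 'w3::ab_group_add) gmod \<Rightarrow> complex \<Rightarrow> ('w1, 'w2, 'w3) log_op \<Rightarrow> ('w1, 'w2, 'w3) log_op" where
  "op_scale W3 a I = (\<lambda>w1 w2 n k. mscale W3 a (I w1 w2 n k))"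

lemma vector_space_op_scale:
  assumes "vector_space (mscale W3)"
  shows "vector_space (op_scale W3)"
proof -
  interpret vector_space "mscale W3" by fact
  show ?thesis
    by unfold_locales
      (auto simp: op_scale_def fun_eq_iff scale_right_distrib scale_left_distrib)
qed

definition fusion_rule ::
  "('v, 'w1::ab_group_add) gmod \<Rightarrow> ('v, 'w2::ab_group_add) gmod \<Rightarrow>
   ('v, 'w3::ab_group_add) gmod \<Rightarrow>
   ('g::ab_group_add \<Rightarrow> 'w1 set) \<Rightarrow> ('g \<Rightarrow> 'w2 set) \<Rightarrow> ('g \<Rightarrow> 'w3 set) \<Rightarrow>
   ('w1, 'w2, 'w3) log_op rel" where
  "fusion_rule W1 W2 W3 H1 H2 H3 =
     card_dim (op_scale W3) (intertwining_space W1 W2 W3 H1 H2 H3)"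

unbundle cardinal_syntax

end

theory Submission
  imports Defs "HOL-Computational_Algebra.Formal_Power_Series"
begin

text \<open>
  Put \<open>J(w\<^sub>1, x) w\<^sub>2 = Y(w\<^sub>1, e\<^sup>\<zeta> x) w\<^sub>2\<close> with \<open>\<zeta> = (2r + 1)\<pi>\<i>\<close>. As \<open>e\<^sup>\<zeta> = -1\<close>, the series
  \<open>J\<close> satisfies the axioms of \<open>Y\<close> with \<open>x\<close> replaced by \<open>-x\<close>. Conjugation by \<open>e\<^sup>x\<^sup>D\<close>, where
  \<open>D = L(-1)\<close>, turns \<open>Y\<^sub>3(v, x\<^sub>1)\<close> into \<open>Y\<^sub>3(v, x\<^sub>1 - x)\<close> and \<open>L(j)\<close> into
  \<open>\<Sum>q. (j+1 choose q) x\<^sup>q L(j - q)\<close>. By Vandermonde's identity the first fact makes the three terms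
  of the Jacobi identity for \<open>e\<^sup>x\<^sup>D J\<close> equal to \<open>e\<^sup>x\<^sup>D\<close> applied to those of the identity for \<open>J\<close>
  with the exponents of \<open>x\<^sub>0\<close> and \<open>x\<^sub>1\<close> interchanged; the second gives the \<open>sl(2)\<close> relations. The
  substitution for \<open>-r - 1\<close> has \<open>-\<zeta>\<close> in place of \<open>\<zeta>\<close> and turns \<open>e\<^sup>x\<^sup>D\<close> into \<open>e\<^sup>-\<^sup>x\<^sup>D\<close>, hence
  undoes the one for \<open>r\<close>.
\<close>

section \<open>Finitely supported sums\<close>

lemma Sum_any_eq_sum_atMost:
  assumes "\<And>m. m > (N::nat) \<Longrightarrow> g m = (0::'a::comm_monoid_add)"
  shows "Sum_any g = sum g {..N}"
proof (rule Sum_any.expand_superset)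
  show "{a. g a \<noteq> 0} \<subseteq> {..N}"
    using assms by (metis (mono_tags, lifting) atMost_iff leI mem_Collect_eq subsetI)
qed simp

lemma Sum_any_reindex_inj:
  fixes g :: "'b \<Rightarrow> 'a::comm_monoid_add"
  assumes "inj h" and "\<And>x. x \<notin> range h \<Longrightarrow> g x = 0"
  shows "Sum_any g = Sum_any (\<lambda>y. g (h y))"
proof -
  have *: "{x. g x \<noteq> 0} = h ` {y. g (h y) \<noteq> 0}"
    using assms(2) by (force simp: image_iff)
  have "inj_on h {y. g (h y) \<noteq> 0}"
    using assms(1) by (rule inj_on_subset) simp
  then show ?thesis
    unfolding Sum_any.expand_set * by (subst sum.reindex) (auto simp: o_def)
qed

text \<open>Regroups a double sum by total degree. The vanishing above degree N comes from
  truncation of the series, so the part of the square outside the triangle contributes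
  nothing.\<close>

lemma sum_square_eq_sum_triangle:
  fixes h :: "nat \<Rightarrow> nat \<Rightarrow> 'a::comm_monoid_add"
  assumes "\<And>p q. p + q > N \<Longrightarrow> h p q = 0"
  shows "(\<Sum>p\<le>N. \<Sum>q\<le>N. h p q) = (\<Sum>m\<le>N. \<Sum>p\<le>m. h p (m - p))"
proof -
  have "(\<Sum>p\<le>N. \<Sum>q\<le>N. h p q) = (\<Sum>(p,q)\<in>{..N} \<times> {..N}. h p q)"
    by (simp add: sum.cartesian_product)
  also have "\<dots> = (\<Sum>(p,q)\<in>{(i,j). i + j \<le> N}. h p q)"
  proof (rule sum.mono_neutral_right)
    show "\<forall>i\<in>{..N} \<times> {..N} - {(i,j). i + j \<le> N}. (case i of (p, q) \<Rightarrow> h p q) = 0"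
      by (metis (mono_tags, lifting) DiffD2 assms case_prod_unfold leI mem_Collect_eq)
  qed auto
  also have "\<dots> = (\<Sum>m\<le>N. \<Sum>p\<le>m. h p (m - p))"
    by (rule sum.triangle_reindex_eq)
  finally show ?thesis .
qed

section \<open>The exponential of an operator\<close>

text \<open>The divided power D^i / i!. With the factorial built in, the coefficients of e^(xD)
  compose with binomial coefficients.\<close>

definition divpow :: "(complex \<Rightarrow> 'w::ab_group_add \<Rightarrow> 'w) \<Rightarrow> ('w \<Rightarrow> 'w) \<Rightarrow> nat \<Rightarrow> 'w \<Rightarrow> 'w" where
  "divpow s D i w = s (1 / fact i) ((D ^^ i) w)"

text \<open>The coefficient of x^n in e^(t x D) f(x), for the part f of a series that belongs to one
  fixed power of log x. The parameter t is there for the substitution, which turns t = 1 into t =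
  -1.\<close>

definition exp_ser ::
  "(complex \<Rightarrow> 'w::ab_group_add \<Rightarrow> 'w) \<Rightarrow> ('w \<Rightarrow> 'w) \<Rightarrow> complex \<Rightarrow> (complex \<Rightarrow> 'w) \<Rightarrow> complex \<Rightarrow> 'w" where
  "exp_ser s D t f n = Sum_any (\<lambda>i. s (t ^ i) (divpow s D i (f (n - of_nat i))))"

text \<open>Exponents are bounded below within each coset of the integers, which makes every
  coefficient of \<open>exp_ser\<close> a finite sum.\<close>

definition truncated :: "(complex \<Rightarrow> 'w::zero) \<Rightarrow> bool" where
  "truncated f \<longleftrightarrow> (\<forall>n. \<exists>N. \<forall>m>N. f (n - of_nat m) = 0)"

locale endomorphism = vector_space s
  for s :: "complex \<Rightarrow> 'w::ab_group_add \<Rightarrow> 'w" +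
  fixes D :: "'w \<Rightarrow> 'w"
  assumes D_hom: "module_hom s s D"
begin

lemmas D_simps = module_hom.add[OF D_hom] module_hom.scale[OF D_hom] module_hom.zero[OF D_hom]

lemma divpow_hom: "module_hom s s (divpow s D i)"
proof -
  have "module_hom s s (D ^^ i)"
  proof (induction i)
    case 0 show ?case by (simp add: module_hom_iff module_axioms)
  next
    case (Suc i) then show ?case using D_hom by (simp add: module_hom_iff)
  qed
  then show ?thesis
    by (simp add: module_hom_iff divpow_def scale_right_distrib mult.commute)
qed

lemmas divpow_simps =
  module_hom.add[OF divpow_hom] module_hom.diff[OF divpow_hom] module_hom.scale[OF divpow_hom]
  module_hom.zero[OF divpow_hom] module_hom.sum[OF divpow_hom]

lemma divpow_0: "divpow s D 0 w = w"
  by (simp add: divpow_def)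

lemma divpow_D: "divpow s D i (D w) = s (of_nat (Suc i)) (divpow s D (Suc i) w)"
  by (simp add: divpow_def funpow_swap1 del: of_nat_Suc)

lemma divpow_divpow: "divpow s D p (divpow s D q w) = s (of_nat (p + q choose p)) (divpow s D (p + q) w)"
proof (induction q arbitrary: w)
  case 0 show ?case by (simp add: divpow_0)
next
  case (Suc q)
  \<comment> \<open>The factor q + 1 absorbs the new part of the factorial and leaves a single D, to
    which the induction hypothesis applies. Being nonzero, it is cancelled at the end.\<close>
  have "s (of_nat (Suc q)) (divpow s D p (divpow s D (Suc q) w)) = divpow s D p (divpow s D q (D w))"
    unfolding divpow_D by (simp only: divpow_simps)
  also have "\<dots> = s (of_nat ((p + q choose p) * Suc (p + q))) (divpow s D (p + Suc q) w)"
    unfolding Suc.IH by (simp add: divpow_D ring_distribs)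
  also have "(p + q choose p) * Suc (p + q) = Suc q * (p + Suc q choose p)"
    using Suc_times_binomial_eq[of "p + q" q] binomial_symmetric[of p "p + q"]
      binomial_symmetric[of p "p + Suc q"]
    by (simp add: mult.commute del: binomial_Suc_Suc)
  finally show ?case
    using of_nat_neq_0[of q, where 'a=complex] unfolding of_nat_mult scale_scale[symmetric]
    by (simp only: scale_cancel_left) simp
qed

section \<open>Linearity and composition of exponentials\<close>

lemma exp_ser_eq_sum:
  assumes "\<And>m. m > N \<Longrightarrow> f (n - of_nat m) = 0"
  shows "exp_ser s D t f n = (\<Sum>i\<le>N. s (t ^ i) (divpow s D i (f (n - of_nat i))))"
  unfolding exp_ser_def by (rule Sum_any_eq_sum_atMost) (simp add: assms divpow_simps)

lemma exp_ser_cong: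
  assumes "\<And>i. f (n - of_nat i) = g (n' - of_nat i)"
  shows "exp_ser s D t f n = exp_ser s D t g n'"
  by (simp add: exp_ser_def assms)

lemma exp_ser_eq_0:
  assumes "\<And>i. f (n - of_nat i) = 0"
  shows "exp_ser s D t f n = 0"
  by (simp add: exp_ser_def assms divpow_simps)

lemma truncatedE:
  assumes "truncated (f :: complex \<Rightarrow> 'w)"
  obtains N where "\<And>m. m > N \<Longrightarrow> f (n - of_nat m) = 0"
  using assms unfolding truncated_def by blast

lemma exp_ser_sum:
  assumes "finite A" and "\<And>j. j \<in> A \<Longrightarrow> truncated (f j)"
  shows "exp_ser s D t (\<lambda>n. \<Sum>j\<in>A. s (c j) (f j n)) n = (\<Sum>j\<in>A. s (c j) (exp_ser s D t (f j) n))"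
proof -
  \<comment> \<open>Finitely many truncated series share one bound, so all their exponentials run
    over the same range and the two summations can be swapped.\<close>
  have "\<exists>N. \<forall>j\<in>A. \<forall>m>N. f j (n - of_nat m) = 0"
    using assms
  proof (induction A)
    case (insert j A)
    then obtain N where N: "\<forall>j\<in>A. \<forall>m>N. f j (n - of_nat m) = 0" by auto
    obtain M where M: "\<And>m. m > M \<Longrightarrow> f j (n - of_nat m) = 0"
      using insert.prems by (meson insertI1 truncatedE)
    show ?case by (rule exI[of _ "max M N"]) (use M N in auto)
  qed simp
  then obtain N where N: "\<And>j m. j \<in> A \<Longrightarrow> m > N \<Longrightarrow> f j (n - of_nat m) = 0" by blast
  have "exp_ser s D t (\<lambda>n. \<Sum>j\<in>A. s (c j) (f j n)) n =
      (\<Sum>i\<le>N. s (t ^ i) (divpow s D i (\<Sum>j\<in>A. s (c j) (f j (n - of_nat i)))))"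
    by (rule exp_ser_eq_sum) (simp add: N)
  also have "\<dots> = (\<Sum>i\<le>N. \<Sum>j\<in>A. s (c j) (s (t ^ i) (divpow s D i (f j (n - of_nat i)))))"
    by (simp add: divpow_simps scale_sum_right mult.commute)
  also have "\<dots> = (\<Sum>j\<in>A. s (c j) (exp_ser s D t (f j) n))"
    by (subst sum.swap) (simp add: scale_sum_right exp_ser_eq_sum[of N] N)
  finally show ?thesis .
qed

lemma exp_ser_add:
  assumes "truncated f" "truncated g"
  shows "exp_ser s D t (\<lambda>n. f n + g n) n = exp_ser s D t f n + exp_ser s D t g n"
  \<comment> \<open>A sum of two terms is treated as a family indexed by the Booleans.\<close>
  using exp_ser_sum[of "UNIV::bool set" "\<lambda>b. if b then f else g" t "\<lambda>_. 1" n] assms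
  by (simp add: UNIV_bool add.commute)

lemma exp_ser_scale:
  assumes "truncated f"
  shows "exp_ser s D t (\<lambda>n. s c (f n)) n = s c (exp_ser s D t f n)"
  using exp_ser_sum[of "{()}" "\<lambda>_. f" t "\<lambda>_. c" n] assms by simp

lemma exp_ser_diff:
  assumes "truncated f" "truncated g"
  shows "exp_ser s D t (\<lambda>n. f n - g n) n = exp_ser s D t f n - exp_ser s D t g n"
  using exp_ser_sum[of "UNIV::bool set" "\<lambda>b. if b then f else g" t "\<lambda>b. if b then 1 else -1" n] assms
  by (simp add: UNIV_bool)

text \<open>Composing divided powers yields a binomial coefficient, so the terms of total degree m
  add up to (t + u)^m by the binomial theorem. With u = -t this inverts the exponential.\<close>

lemma exp_ser_exp_ser:
  assumes "truncated f"
  shows "exp_ser s D t (exp_ser s D u f) n = exp_ser s D (t + u) f n"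
proof -
  obtain N where N: "\<And>m. m > N \<Longrightarrow> f (n - of_nat m) = 0" using truncatedE[OF assms, where n=n] by blast
  have N': "f (n - of_nat p - of_nat q) = 0" if "p + q > N" for p q
    using N[OF that] by (simp add: diff_diff_eq)
  define h where "h p q = s (t ^ p) (divpow s D p (s (u ^ q) (divpow s D q (f (n - of_nat p - of_nat q)))))"
    for p q
  have h: "h p q = s (of_nat (p + q choose p) * t ^ p * u ^ q) (divpow s D (p + q) (f (n - of_nat (p + q))))"
    for p q
    by (simp add: h_def divpow_simps divpow_divpow diff_diff_eq mult_ac)
  have "exp_ser s D t (exp_ser s D u f) n =
      (\<Sum>p\<le>N. s (t ^ p) (divpow s D p (exp_ser s D u f (n - of_nat p))))"
    by (rule exp_ser_eq_sum, rule exp_ser_eq_0) (simp add: N')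
  also have "\<dots> = (\<Sum>p\<le>N. \<Sum>q\<le>N. h p q)"
    by (simp add: h_def exp_ser_eq_sum[of N] N' divpow_simps scale_sum_right)
  also have "\<dots> = (\<Sum>m\<le>N. \<Sum>p\<le>m. h p (m - p))"
    by (rule sum_square_eq_sum_triangle) (simp add: h N divpow_simps del: of_nat_add)
  also have "\<dots> = (\<Sum>m\<le>N. s ((t + u) ^ m) (divpow s D m (f (n - of_nat m))))"
    by (intro sum.cong refl) (simp add: h binomial_ring scale_sum_left)
  also have "\<dots> = exp_ser s D (t + u) f n"
    by (rule exp_ser_eq_sum[symmetric]) (rule N)
  finally show ?thesis .
qed

lemma exp_ser_0: "exp_ser s D 0 f n = f n"
proof -
  have "exp_ser s D 0 f n = (\<Sum>i\<le>0. s (0 ^ i) (divpow s D i (f (n - of_nat i))))"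
    unfolding exp_ser_def by (rule Sum_any_eq_sum_atMost) simp
  then show ?thesis by (simp add: divpow_0)
qed

text \<open>The product rule: the derivative of x^i cancels one factor of i! and so produces e^(xD)
  D f. The further term from differentiating powers of log x is added in
  \<open>derivative_Omega\<close>.\<close>

lemma exp_ser_ddx:
  assumes "truncated f"
  shows "s (n + 1) (exp_ser s D 1 f (n + 1)) =
    exp_ser s D 1 (\<lambda>n. s (n + 1) (f (n + 1)) + D (f n)) n"
proof -
  obtain N where N: "\<And>m. m > N \<Longrightarrow> f (n + 1 - of_nat m) = 0" using truncatedE[OF assms, where n="n + 1"] by blast
  \<comment> \<open>One more than N: lowering i by one in the next sum turns the range up to M into
    the range up to N, and the term at M that is then added back is zero.\<close>
  define M where "M = Suc N"
  have M1: "f (n + 1 - of_nat m) = 0" if "m > M" for m using N[of m] that by (simp add: M_def)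
  have M2: "f (n - of_nat m) = 0" if "m > N" for m using N[of "Suc m"] that by simp
  have "(\<Sum>i\<le>M. s (of_nat i) (divpow s D i (f (n + 1 - of_nat i)))) =
      (\<Sum>i\<le>N. divpow s D i (D (f (n - of_nat i))))"
    unfolding M_def sum.atMost_Suc_shift by (simp add: divpow_D del: of_nat_Suc) simp
  also have "\<dots> = (\<Sum>i\<le>M. divpow s D i (D (f (n - of_nat i))))"
    using M2[of M] by (simp add: M_def D_simps divpow_simps)
  finally have *: "(\<Sum>i\<le>M. s (of_nat i) (divpow s D i (f (n + 1 - of_nat i)))) =
      (\<Sum>i\<le>M. divpow s D i (D (f (n - of_nat i))))" .
  \<comment> \<open>The factor n + 1 splits as (n - i + 1) + i: the first part differentiates f, the
    second differentiates x^i.\<close>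
  have "s (n + 1) (exp_ser s D 1 f (n + 1)) = 
      (\<Sum>i\<le>M. s (n - of_nat i + 1 + of_nat i) (divpow s D i (f (n + 1 - of_nat i))))"
    by (simp add: exp_ser_eq_sum[of M] M1 scale_sum_right)
  also have "\<dots> = (\<Sum>i\<le>M. s (n - of_nat i + 1) (divpow s D i (f (n + 1 - of_nat i)))) +
      (\<Sum>i\<le>M. s (of_nat i) (divpow s D i (f (n + 1 - of_nat i))))"
    unfolding scale_left_distrib by (simp add: sum.distrib)
  also have "\<dots> = (\<Sum>i\<le>M. divpow s D i (s (n - of_nat i + 1) (f (n - of_nat i + 1)) + D (f (n - of_nat i))))"
    unfolding * by (simp add: divpow_simps sum.distrib sum_subtractf algebra_simps)
  also have "\<dots> = exp_ser s D 1 (\<lambda>n. s (n + 1) (f (n + 1)) + D (f n)) n"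
  proof -
    have "s (n - of_nat m + 1) (f (n - of_nat m + 1)) + D (f (n - of_nat m)) = 0" if "m > M" for m
    proof -
      have *: "n - of_nat m + 1 = n + 1 - of_nat m" by simp
      show ?thesis unfolding * using M1[OF that] M2[of m] that by (simp add: D_simps M_def)
    qed
    then show ?thesis by (simp add: exp_ser_eq_sum[of M])
  qed
  finally show ?thesis .
qed

text \<open>
  The family \<open>B\<close> consists of the coefficients of \<open>e\<^sup>-\<^sup>x\<^sup>D B\<^sub>0 e\<^sup>x\<^sup>D\<close>, since the hypothesis reads
  \<open>[B q, D] = (q + 1) B (q + 1)\<close>.
\<close>

lemma divpow_conjugate:
  assumes B: "\<And>q w. B q (D w) = D (B q w) + s (of_nat (Suc q)) (B (Suc q) w)"
    and B_hom: "\<And>q. module_hom s s (B q)"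
  shows "B 0 (divpow s D m w) = (\<Sum>q\<le>m. divpow s D (m - q) (B q w))"
proof (induction m arbitrary: w)
  case 0 show ?case by (simp add: divpow_0)
next
  case (Suc m)
  let ?f = "\<lambda>q. divpow s D (Suc m - q) (B q w)"
  \<comment> \<open>Multiplying by m + 1 splits off one D. Moving it through the family gives each
    term of index q the weight m + 1 - q from the summand with D in front and the weight q from the
    commutator; together these are m + 1 again.\<close>
  have "s (of_nat (Suc m)) (B 0 (divpow s D (Suc m) w)) = B 0 (divpow s D m (D w))"
    by (simp add: divpow_D module_hom.scale[OF B_hom] del: of_nat_Suc)
  also have "\<dots> = (\<Sum>q\<le>m. divpow s D (m - q) (D (B q w))) +
      (\<Sum>q\<le>m. s (of_nat (Suc q)) (divpow s D (m - q) (B (Suc q) w)))"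
    by (simp add: Suc.IH B divpow_simps sum.distrib del: of_nat_Suc)
  also have "(\<Sum>q\<le>m. divpow s D (m - q) (D (B q w))) = (\<Sum>q\<le>Suc m. s (of_nat (Suc m - q)) (?f q))"
    by (simp add: divpow_D Suc_diff_le del: of_nat_Suc of_nat_diff)
  also have "(\<Sum>q\<le>m. s (of_nat (Suc q)) (divpow s D (m - q) (B (Suc q) w))) =
      (\<Sum>q\<le>Suc m. s (of_nat q) (?f q))"
    unfolding sum.atMost_Suc_shift[of _ m] by (simp del: of_nat_Suc)
  also have "(\<Sum>q\<le>Suc m. s (of_nat (Suc m - q)) (?f q)) + (\<Sum>q\<le>Suc m. s (of_nat q) (?f q)) =
      s (of_nat (Suc m)) (\<Sum>q\<le>Suc m. ?f q)"
    unfolding sum.distrib[symmetric] scale_sum_right scale_left_distrib[symmetric]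
    by (intro sum.cong refl) (simp add: of_nat_diff)
  finally show ?case by (simp del: of_nat_Suc sum.atMost_Suc)
qed

text \<open>\<open>divpow_conjugate\<close> in every degree, regrouped by q: as operators, B 0
  e^(xD) = e^(xD) (sum of x^q B q), with multiplication by x^q appearing as a shift of the
  exponent.\<close>

lemma exp_ser_conjugate:
  assumes B: "\<And>q w. B q (D w) = D (B q w) + s (of_nat (Suc q)) (B (Suc q) w)"
    and B_hom: "\<And>q. module_hom s s (B q)"
    and N: "\<And>m. m > N \<Longrightarrow> f (n - of_nat m) = 0"
  shows "B 0 (exp_ser s D 1 f n) = (\<Sum>q\<le>N. exp_ser s D 1 (\<lambda>n. B q (f n)) (n - of_nat q))"
proof -
  define h where "h q p = divpow s D p (B q (f (n - of_nat q - of_nat p)))" for p q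
  have h0: "B q (f (n - of_nat q - of_nat p)) = 0" if "q + p > N" for p q
    using N[OF that] by (simp add: diff_diff_eq module_hom.zero[OF B_hom])
  have "B 0 (exp_ser s D 1 f n) = (\<Sum>m\<le>N. B 0 (divpow s D m (f (n - of_nat m))))"
    by (simp add: exp_ser_eq_sum[of N] N module_hom.sum[OF B_hom])
  also have "\<dots> = (\<Sum>m\<le>N. \<Sum>q\<le>m. h q (m - q))"
    unfolding divpow_conjugate[OF B B_hom] h_def
    by (intro sum.cong refl) (simp add: of_nat_diff algebra_simps)
  also have "\<dots> = (\<Sum>q\<le>N. \<Sum>p\<le>N. h q p)"
    by (rule sum_square_eq_sum_triangle[symmetric]) (simp add: h_def h0 divpow_simps)
  also have "\<dots> = (\<Sum>q\<le>N. exp_ser s D 1 (\<lambda>n. B q (f n)) (n - of_nat q))"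
    by (simp add: h_def exp_ser_eq_sum[of N] h0)
  finally show ?thesis .
qed

text \<open>For terminating families, such as those of L(-1), L(0) and L(1), the range of the sum
  does not depend on the series.\<close>

lemma exp_ser_conjugate_finite:
  assumes B: "\<And>q w. B q (D w) = D (B q w) + s (of_nat (Suc q)) (B (Suc q) w)"
    and B_hom: "\<And>q. module_hom s s (B q)"
    and Q: "\<And>q w. q > Q \<Longrightarrow> B q w = 0"
    and "truncated f"
  shows "B 0 (exp_ser s D 1 f n) = (\<Sum>q\<le>Q. exp_ser s D 1 (\<lambda>n. B q (f n)) (n - of_nat q))"
proof -
  obtain N where N: "\<And>m. m > N \<Longrightarrow> f (n - of_nat m) = 0"
    using truncatedE[OF \<open>truncated f\<close>, where n=n] by blast
  have "B 0 (exp_ser s D 1 f n) = (\<Sum>q\<le>max N Q. exp_ser s D 1 (\<lambda>n. B q (f n)) (n - of_nat q))"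
    by (rule exp_ser_conjugate[OF B B_hom]) (simp add: N)
  also have "\<dots> = (\<Sum>q\<le>Q. exp_ser s D 1 (\<lambda>n. B q (f n)) (n - of_nat q))"
    by (rule sum.mono_neutral_right) (auto intro!: exp_ser_eq_0 simp: Q)
  finally show ?thesis .
qed

section \<open>Shifts, linear images and finite sums of truncated series\<close>

lemma exp_ser_shift: "exp_ser s D t (\<lambda>n. f (n + x)) n = exp_ser s D t f (n + x)"
  by (rule exp_ser_cong) (simp add: algebra_simps)

lemma truncated_shift:
  fixes f :: "complex \<Rightarrow> 'w"
  assumes "truncated f"
  shows "truncated (\<lambda>n. f (n + x))"
  unfolding truncated_def
proof
  fix n
  obtain N where "\<And>m. m > N \<Longrightarrow> f (n + x - of_nat m) = 0"
    using truncatedE[OF assms, where n="n + x"] by blast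
  then show "\<exists>N. \<forall>m>N. f (n - of_nat m + x) = 0" by (auto simp: algebra_simps)
qed

lemma truncated_hom:
  assumes "truncated f" "module_hom s s F"
  shows "truncated (\<lambda>n. F (f n))"
  using assms(1) unfolding truncated_def by (metis module_hom.zero[OF assms(2)])

lemma truncated_sum:
  assumes "finite A" and "\<And>j. j \<in> A \<Longrightarrow> truncated (f j)"
  shows "truncated (\<lambda>n. \<Sum>j\<in>A. s (c j) (f j n))"
  unfolding truncated_def
proof
  fix n
  have "\<forall>\<^sub>F M in sequentially. \<forall>j\<in>A. \<forall>m>M. f j (n - of_nat m) = 0"
  proof (intro eventually_ball_finite \<open>finite A\<close> ballI)
    fix j assume "j \<in> A"
    obtain N where N: "\<And>m. m > N \<Longrightarrow> f j (n - of_nat m) = 0"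
      using truncatedE[OF assms(2)[OF \<open>j \<in> A\<close>], where n=n] by blast
    show "\<forall>\<^sub>F M in sequentially. \<forall>m>M. f j (n - of_nat m) = 0"
      unfolding eventually_sequentially by (rule exI[of _ N]) (use N in auto)
  qed
  then obtain N where "\<forall>j\<in>A. \<forall>m>N. f j (n - of_nat m) = 0"
    by (auto simp: eventually_sequentially)
  then show "\<exists>N. \<forall>m>N. (\<Sum>j\<in>A. s (c j) (f j (n - of_nat m))) = 0"
    by (intro exI[of _ N]) simp
qed

end

section \<open>The substitution \<open>x \<mapsto> e\<^sup>\<zeta> x\<close>\<close>

text \<open>Both sides are the coefficient of T^k in (x + y + T)^j; the left side expands first in
  powers of x + T.\<close>

lemma sum_binomial_compose:
  fixes x y :: complex
  assumes "j \<le> N"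
  shows "(\<Sum>l\<le>N. (of_nat (l choose k) * x ^ (l - k)) * (of_nat (j choose l) * y ^ (j - l))) =
    of_nat (j choose k) * (x + y) ^ (j - k)"
proof -
  let ?g = "\<lambda>l. (of_nat (l choose k) * x ^ (l - k)) * (of_nat (j choose l) * y ^ (j - l))"
  show ?thesis
  proof (cases "k \<le> j")
    case False
    then have "?g l = 0" for l
      by (cases "l < k") (auto simp: binomial_eq_0)
    then have "sum ?g {..N} = 0" by (intro sum.neutral) blast
    with False show ?thesis by (simp add: binomial_eq_0)
  next
    case True
    have "sum ?g {..N} = sum ?g {k..j}"
      by (rule sum.mono_neutral_right) (use assms in \<open>auto simp: not_le\<close>)
    also have "\<dots> = (\<Sum>i\<le>j - k. ?g (i + k))"
      using sum.shift_bounds_cl_nat_ivl[of ?g 0 k "j - k"] True by (simp add: atLeast0AtMost)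
    also have "\<dots> = (\<Sum>i\<le>j - k. of_nat (j choose k) * (of_nat (j - k choose i) * x ^ i * y ^ (j - k - i)))"
    proof (intro sum.cong refl)
      fix i assume "i \<in> {..j - k}"
      then have "(j choose (i + k)) * (i + k choose k) = (j choose k) * (j - k choose i)"
        using choose_mult[of k "i + k" j] True by simp
      then have "of_nat (j choose (i + k)) * of_nat (i + k choose k) =
          (of_nat (j choose k) * of_nat (j - k choose i) :: complex)"
        by (metis of_nat_mult)
      then show "?g (i + k) = of_nat (j choose k) * (of_nat (j - k choose i) * x ^ i * y ^ (j - k - i))"
        by (simp add: add.commute mult_ac)
    qed
    also have "\<dots> = of_nat (j choose k) * (x + y) ^ (j - k)"
      by (simp add: binomial_ring sum_distrib_left)
    finally show ?thesis .
  qed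
qed

lemma log_seriesE:
  assumes "log_series f"
  obtains N where "\<And>j. j > N \<Longrightarrow> f n j = 0"
proof -
  have "finite {k. f n k \<noteq> 0}" using assms by (simp add: log_series_def)
  then obtain N where "\<forall>k\<in>{k. f n k \<noteq> 0}. k \<le> N" by (meson finite_nat_set_iff_bounded_le)
  then show ?thesis using that[of N] by (metis (mono_tags, lifting) linorder_not_less mem_Collect_eq)
qed

context vector_space
begin

lemma id_hom: "module_hom scale scale (\<lambda>w. w)"
  by (simp add: module_hom_iff module_axioms)

lemma scale_comp_hom: "module_hom scale scale f \<Longrightarrow> module_hom scale scale (\<lambda>w. scale c (f w))"
  by (simp add: module_hom_iff scale_right_distrib mult.commute)

end

context
  fixes s :: "complex \<Rightarrow> 'w::ab_group_add \<Rightarrow> 'w"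
  assumes vs: "vector_space s"
begin

interpretation vector_space s by (rule vs)

lemma subst_exp_eq_sum:
  assumes "\<And>j. j > N \<Longrightarrow> f n j = 0"
  shows "subst_exp s \<zeta> f n k =
    (\<Sum>j\<le>N. s (exp (\<zeta> * n) * of_nat (j choose k) * \<zeta> ^ (j - k)) (f n j))"
  unfolding subst_exp_def by (rule Sum_any_eq_sum_atMost) (simp add: assms)

lemma subst_exp_eq_0:
  assumes "\<And>j. f n j = 0"
  shows "subst_exp s \<zeta> f n k = 0"
  by (simp add: subst_exp_def assms)

lemma subst_exp_bound:
  assumes N: "\<And>j. j > N \<Longrightarrow> f n j = 0" and "k > N"
  shows "subst_exp s \<zeta> f n k = 0"
  using \<open>k > N\<close> by (simp add: subst_exp_eq_sum[of N f n, OF N] binomial_eq_0)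

lemma log_series_subst_exp:
  assumes "log_series f"
  shows "log_series (subst_exp s \<zeta> f)"
  unfolding log_series_def
proof
  fix n
  obtain N where "\<And>j. j > N \<Longrightarrow> f n j = 0" using log_seriesE[OF assms, where n=n] by blast
  then have "{k. subst_exp s \<zeta> f n k \<noteq> 0} \<subseteq> {..N}"
    using subst_exp_bound[of N f n] by (force simp: not_le[symmetric])
  then show "finite {k. subst_exp s \<zeta> f n k \<noteq> 0}" by (rule finite_subset) simp
qed

text \<open>On powers of x the exponential factors multiply; on powers of log x the shifts \<zeta>
  and \<eta> add, which is \<open>sum_binomial_compose\<close>.\<close>

lemma subst_exp_subst_exp:
  assumes "log_series f"
  shows "subst_exp s \<zeta> (subst_exp s \<eta> f) = subst_exp s (\<zeta> + \<eta>) f"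
proof (intro ext)
  fix n k
  obtain N where N: "\<And>j. j > N \<Longrightarrow> f n j = 0" using log_seriesE[OF assms, where n=n] by blast
  have "subst_exp s \<zeta> (subst_exp s \<eta> f) n k = (\<Sum>l\<le>N. \<Sum>j\<le>N.
      s (exp (\<zeta> * n) * of_nat (l choose k) * \<zeta> ^ (l - k) *
        (exp (\<eta> * n) * of_nat (j choose l) * \<eta> ^ (j - l))) (f n j))"
    using subst_exp_bound[of N f n, OF N]
    by (simp add: subst_exp_eq_sum[of N] N scale_sum_right)
  also have "\<dots> = (\<Sum>j\<le>N. s (exp (\<zeta> * n) * exp (\<eta> * n) * (\<Sum>l\<le>N.
      (of_nat (l choose k) * \<zeta> ^ (l - k)) * (of_nat (j choose l) * \<eta> ^ (j - l)))) (f n j))"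
    by (subst sum.swap) (simp add: scale_sum_left sum_distrib_left mult_ac)
  also have "\<dots> = subst_exp s (\<zeta> + \<eta>) f n k"
    by (subst subst_exp_eq_sum[of N f, OF N], assumption, intro sum.cong refl)
      (simp only: atMost_iff sum_binomial_compose, simp add: exp_add distrib_right mult.assoc)
  finally show "subst_exp s \<zeta> (subst_exp s \<eta> f) n k = subst_exp s (\<zeta> + \<eta>) f n k" .
qed

lemma subst_exp_0: "subst_exp s 0 f = f"
proof (intro ext)
  fix n k
  have "subst_exp s 0 f n k = Sum_any (\<lambda>j. if j = k then f n j else 0)"
    unfolding subst_exp_def by (rule Sum_any.cong) (auto simp: power_0_left binomial_eq_0)
  then show "subst_exp s 0 f n k = f n k" by simp
qed

text \<open>Carries a linear relation between coefficients through the substitution: the outer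
  weights depend only on n, j and k, while \<open>e i\<close> records how the exponent
  \<open>p i\<close> differs from n. Asserting it for all large M allows several instances to be
  compared at one M.\<close>

lemma subst_exp_linear_combination:
  assumes "finite A"
    and hom: "\<And>i. i \<in> A \<Longrightarrow> module_hom s s (F i)"
    and ser: "\<And>i. i \<in> A \<Longrightarrow> log_series (g i)"
    and p: "\<And>i. i \<in> A \<Longrightarrow> exp (\<zeta> * p i) = exp (\<zeta> * n) * e i"
  shows "\<forall>\<^sub>F M in sequentially. (\<Sum>i\<in>A. F i (subst_exp s \<zeta> (g i) (p i) k)) =
    (\<Sum>j\<le>M. s (exp (\<zeta> * n) * of_nat (j choose k) * \<zeta> ^ (j - k)) (\<Sum>i\<in>A. s (e i) (F i (g i (p i) j))))"
proof -
  have "\<forall>\<^sub>F M in sequentially. \<forall>i\<in>A. \<forall>j>M. g i (p i) j = 0"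
  proof (intro eventually_ball_finite \<open>finite A\<close> ballI)
    fix i assume "i \<in> A"
    obtain N where N: "\<And>j. j > N \<Longrightarrow> g i (p i) j = 0"
      using log_seriesE[OF ser[OF \<open>i \<in> A\<close>], where n="p i"] by blast
    show "\<forall>\<^sub>F M in sequentially. \<forall>j>M. g i (p i) j = 0"
      unfolding eventually_sequentially by (rule exI[of _ N]) (use N in auto)
  qed
  then show ?thesis
  proof eventually_elim
    case (elim M)
    have "(\<Sum>i\<in>A. F i (subst_exp s \<zeta> (g i) (p i) k)) = (\<Sum>i\<in>A. \<Sum>j\<le>M.
        s (exp (\<zeta> * n) * of_nat (j choose k) * \<zeta> ^ (j - k)) (s (e i) (F i (g i (p i) j))))"
    proof (intro sum.cong refl)
      fix i assume "i \<in> A"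
      then have "F i (subst_exp s \<zeta> (g i) (p i) k) =
          (\<Sum>j\<le>M. s (exp (\<zeta> * p i) * of_nat (j choose k) * \<zeta> ^ (j - k)) (F i (g i (p i) j)))"
        using elim hom[OF \<open>i \<in> A\<close>]
        by (simp add: subst_exp_eq_sum[of M] module_hom.sum[of s s "F i"] module_hom.scale[of s s "F i"])
      also have "\<dots> = (\<Sum>j\<le>M. s (exp (\<zeta> * n) * of_nat (j choose k) * \<zeta> ^ (j - k)) (s (e i) (F i (g i (p i) j))))"
        using p[OF \<open>i \<in> A\<close>] by (simp add: mult_ac)
      finally show "F i (subst_exp s \<zeta> (g i) (p i) k) = \<dots>" .
    qed
    also have "\<dots> = (\<Sum>j\<le>M. \<Sum>i\<in>A.
        s (exp (\<zeta> * n) * of_nat (j choose k) * \<zeta> ^ (j - k)) (s (e i) (F i (g i (p i) j))))"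
      by (rule sum.swap)
    finally show ?case by (simp only: scale_sum_right)
  qed
qed

lemma subst_exp_add:
  assumes "log_series f" "log_series g"
  shows "subst_exp s \<zeta> (\<lambda>n k. f n k + g n k) n k = subst_exp s \<zeta> f n k + subst_exp s \<zeta> g n k"
proof -
  obtain M where M: "\<And>j. j > M \<Longrightarrow> f n j = 0" using log_seriesE[OF assms(1), where n=n] by blast
  obtain N where N: "\<And>j. j > N \<Longrightarrow> g n j = 0" using log_seriesE[OF assms(2), where n=n] by blast
  show ?thesis
    using M N by (simp add: subst_exp_eq_sum[of "max M N"] scale_right_distrib sum.distrib)
qed

lemma subst_exp_scale:
  assumes "log_series f"
  shows "subst_exp s \<zeta> (\<lambda>n k. s c (f n k)) n k = s c (subst_exp s \<zeta> f n k)"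
proof -
  obtain N where N: "\<And>j. j > N \<Longrightarrow> f n j = 0" using log_seriesE[OF assms, where n=n] by blast
  then show ?thesis
    by (simp add: subst_exp_eq_sum[of N] scale_sum_right mult_ac)
qed

text \<open>The chain rule for the substitution; the outer factor is the derivative of e^\<zeta>
  x.\<close>

lemma ddx_log_subst_exp:
  assumes "log_series f"
  shows "ddx_log s (subst_exp s \<zeta> f) n k = s (exp \<zeta>) (subst_exp s \<zeta> (ddx_log s f) n k)"
proof -
  let ?c = "\<lambda>j k. of_nat (j choose k) * \<zeta> ^ (j - k)"
  let ?x = "exp (\<zeta> * (n + 1))"
  obtain N where N: "\<And>j. j > N \<Longrightarrow> f (n + 1) j = 0"
    using log_seriesE[OF assms, where n="n + 1"] by blast
  have x: "exp \<zeta> * exp (\<zeta> * n) = ?x"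
    by (simp add: exp_add[symmetric] ring_distribs add.commute)
  \<comment> \<open>The absorption identity: it compares coefficients of powers of log x in the
    derivative of (\<zeta> + log x)^(j + 1).\<close>
  have c: "of_nat (Suc j) * ?c j k = of_nat (Suc k) * ?c (Suc j) (Suc k)" for j
    using binomial_absorption[of k "Suc j"] by (simp only: mult.assoc[symmetric] of_nat_mult[symmetric]) simp
  have "s (exp \<zeta>) (subst_exp s \<zeta> (ddx_log s f) n k) =
      (\<Sum>j\<le>N. s (?x * ?c j k) (s (n + 1) (f (n + 1) j) + s (of_nat (Suc j)) (f (n + 1) (Suc j))))"
    by (simp add: subst_exp_eq_sum[of N] ddx_log_def N scale_sum_right x mult.assoc[symmetric] del: of_nat_Suc)
  also have "\<dots> = (\<Sum>j\<le>N. s (n + 1) (s (?x * ?c j k) (f (n + 1) j))) +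
      (\<Sum>j\<le>N. s (?x * (of_nat (Suc j) * ?c j k)) (f (n + 1) (Suc j)))"
    by (simp add: scale_right_distrib sum.distrib mult_ac del: of_nat_Suc)
  also have "(\<Sum>j\<le>N. s (?x * (of_nat (Suc j) * ?c j k)) (f (n + 1) (Suc j))) =
      (\<Sum>j\<le>N. s (of_nat (Suc k)) (s (?x * ?c (Suc j) (Suc k)) (f (n + 1) (Suc j))))"
    unfolding c by (simp add: mult_ac del: of_nat_Suc binomial_Suc_Suc)
  also have "\<dots> = (\<Sum>j\<le>Suc N. s (of_nat (Suc k)) (s (?x * ?c j (Suc k)) (f (n + 1) j)))"
    unfolding sum.atMost_Suc_shift[of _ N] by (simp del: of_nat_Suc binomial_Suc_Suc)
  also have "\<dots> = (\<Sum>j\<le>N. s (of_nat (Suc k)) (s (?x * ?c j (Suc k)) (f (n + 1) j)))"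
    by (simp add: N)
  also have "(\<Sum>j\<le>N. s (n + 1) (s (?x * ?c j k) (f (n + 1) j))) + \<dots> = ddx_log s (subst_exp s \<zeta> f) n k"
    by (simp add: ddx_log_def subst_exp_eq_sum[of N] N scale_sum_right mult.assoc del: of_nat_Suc)
  finally show ?thesis by simp
qed

end

lemma exp_shift_minus_one:
  assumes "exp \<zeta> = (-1 :: complex)"
  shows "exp (\<zeta> * (n + of_int m)) = exp (\<zeta> * n) * (-1) powi m"
  using exp_power_int[of \<zeta> m] assms by (simp add: ring_distribs exp_add mult.commute)

text \<open>One bound serves all powers of log x, as in the lower truncation axiom. Without
  uniformity a coefficient of e^(xD) f could involve infinitely many powers of log x.\<close>

definition truncated_log :: "'w::zero log_ser \<Rightarrow> bool" where
  "truncated_log f \<longleftrightarrow> (\<forall>n. \<exists>N. \<forall>m>N. \<forall>k. f (n - of_nat m) k = 0)"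

lemma truncated_logE:
  assumes "truncated_log f"
  obtains N where "\<And>m k. m > N \<Longrightarrow> f (n - of_nat m) k = 0"
  using assms unfolding truncated_log_def by blast

lemma truncated_log_imp_truncated: "truncated_log f \<Longrightarrow> truncated (\<lambda>n. f n k)"
  unfolding truncated_def truncated_log_def by blast

lemma truncated_log_subst_exp:
  assumes "vector_space s" "truncated_log f"
  shows "truncated_log (subst_exp s \<zeta> f)"
  using assms subst_exp_eq_0[OF assms(1)] unfolding truncated_log_def by meson

section \<open>The substitution applied to an exponential\<close>

context endomorphism
begin

lemma exp_xD_eq: "exp_xD s D f n k = exp_ser s D 1 (\<lambda>n. f n k) n"
  by (simp add: exp_xD_def exp_ser_def divpow_def)

lemma truncated_log_exp_ser:
  assumes "truncated_log f"
  shows "truncated_log (\<lambda>n k. exp_ser s D t (\<lambda>n. f n k) n)"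
  unfolding truncated_log_def
proof
  fix n
  obtain N where N: "\<And>m k. m > N \<Longrightarrow> f (n - of_nat m) k = 0"
    using truncated_logE[OF assms, where n=n] by blast
  have "exp_ser s D t (\<lambda>n. f n k) (n - of_nat m) = 0" if "m > N" for m k
    using N[of "m + _"] that by (intro exp_ser_eq_0) (simp add: diff_diff_eq)
  then show "\<exists>N. \<forall>m>N. \<forall>k. exp_ser s D t (\<lambda>n. f n k) (n - of_nat m) = 0" by blast
qed

text \<open>By uniform truncation only finitely many coefficients of f enter, and each is a
  polynomial in log x.\<close>

lemma log_series_exp_ser:
  assumes "truncated_log f" "log_series f"
  shows "log_series (\<lambda>n k. exp_ser s D t (\<lambda>n. f n k) n)"
  unfolding log_series_def
proof
  fix n
  obtain N where N: "\<And>m k. m > N \<Longrightarrow> f (n - of_nat m) k = 0"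
    using truncated_logE[OF assms(1), where n=n] by blast
  have "exp_ser s D t (\<lambda>n. f n k) n = 0" if "\<forall>i\<le>N. f (n - of_nat i) k = 0" for k
    using that N by (intro exp_ser_eq_0) (meson leI)
  then have "{k. exp_ser s D t (\<lambda>n. f n k) n \<noteq> 0} \<subseteq> (\<Union>i\<le>N. {k. f (n - of_nat i) k \<noteq> 0})"
    by blast
  then show "finite {k. exp_ser s D t (\<lambda>n. f n k) n \<noteq> 0}"
    by (rule finite_subset) (use assms(2) in \<open>simp add: log_series_def\<close>)
qed

text \<open>The factor x^i that accompanies D^i becomes e^(i \<zeta>) x^i, which multiplies t by
  e^\<zeta>.\<close>

lemma subst_exp_exp_ser:
  assumes "truncated_log f" "log_series f"
  shows "subst_exp s \<zeta> (\<lambda>n k. exp_ser s D t (\<lambda>n. f n k) n) n k =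
    exp_ser s D (t * exp \<zeta>) (\<lambda>n. subst_exp s \<zeta> f n k) n"
proof -
  note vs = vector_space_axioms
  obtain N where N: "\<And>m k. m > N \<Longrightarrow> f (n - of_nat m) k = 0"
    using truncated_logE[OF assms(1), where n=n] by blast
  \<comment> \<open>The i-th term reads f at exponent n - i, which costs a factor e^(-i \<zeta>);
    the factor (t e^\<zeta>)^i in front compensates it and leaves t^i.\<close>
  have e: "exp (\<zeta> * (n - of_nat i)) = exp (\<zeta> * n) * exp (- \<zeta>) ^ i" for i
    by (simp add: ring_distribs exp_diff exp_of_nat_mult[symmetric] mult.commute exp_minus field_simps)
  have e': "(t * exp \<zeta>) ^ i * exp (- \<zeta>) ^ i = t ^ i" for i
    by (simp add: exp_minus mult.assoc flip: power_mult_distrib)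
  have 1: "\<forall>\<^sub>F M in sequentially. 
      (\<Sum>i\<le>N. s ((t * exp \<zeta>) ^ i) (divpow s D i (subst_exp s \<zeta> f (n - of_nat i) k))) =
      (\<Sum>j\<le>M. s (exp (\<zeta> * n) * of_nat (j choose k) * \<zeta> ^ (j - k))
        (\<Sum>i\<le>N. s (exp (- \<zeta>) ^ i) (s ((t * exp \<zeta>) ^ i) (divpow s D i (f (n - of_nat i) j)))))"
    by (rule subst_exp_linear_combination[OF vs]) (simp_all add: scale_comp_hom divpow_hom assms e)
  \<comment> \<open>The left side of the claim is put into the same shape as a family with one
    member, so that both sides can be compared at a common M.\<close>
  have 2: "\<forall>\<^sub>F M in sequentially. 
      (\<Sum>i\<in>{()}. subst_exp s \<zeta> (\<lambda>n k. exp_ser s D t (\<lambda>n. f n k) n) n k) =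
      (\<Sum>j\<le>M. s (exp (\<zeta> * n) * of_nat (j choose k) * \<zeta> ^ (j - k))
        (\<Sum>i\<in>{()}. s 1 (exp_ser s D t (\<lambda>n. f n j) n)))"
    by (rule subst_exp_linear_combination[OF vs]) (simp_all add: id_hom log_series_exp_ser assms)
  have "\<forall>\<^sub>F M in sequentially. subst_exp s \<zeta> (\<lambda>n k. exp_ser s D t (\<lambda>n. f n k) n) n k =
      (\<Sum>i\<le>N. s ((t * exp \<zeta>) ^ i) (divpow s D i (subst_exp s \<zeta> f (n - of_nat i) k)))"
    using 1 2
  proof eventually_elim
    case (elim M)
    then show ?case using e' by (simp add: exp_ser_eq_sum[of N] N mult.commute)
  qed
  then have "subst_exp s \<zeta> (\<lambda>n k. exp_ser s D t (\<lambda>n. f n k) n) n k =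
      (\<Sum>i\<le>N. s ((t * exp \<zeta>) ^ i) (divpow s D i (subst_exp s \<zeta> f (n - of_nat i) k)))"
    by simp
  also have "\<dots> = exp_ser s D (t * exp \<zeta>) (\<lambda>n. subst_exp s \<zeta> f n k) n"
    by (rule exp_ser_eq_sum[symmetric]) (simp add: subst_exp_eq_0[OF vs] N)
  finally show ?thesis .
qed

end

section \<open>The Jacobi identity in components\<close>

text \<open>In each product one exponent is forced by the vector-valued factor and another by
  homogeneity of the delta function. The sum that remains runs over the power i of the second term
  of the binomial.\<close>

lemma jacobi_identity_iff:
  fixes I :: "'w1::zero \<Rightarrow> 'w2 \<Rightarrow> 'e::ring_1 \<Rightarrow> 'w3::ab_group_add"
  assumes "vector_space s"
  shows "jacobi_identity s Y1 Y2 Y3 I \<longleftrightarrow> (\<forall>v w1 w2 a b c.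
      Sum_any (\<lambda>i. s ((of_int (- a - 1) gchoose i) * (-1) ^ i)
        (Y3 v (I w1 w2 (c - of_nat i)) (b + a + 1 + int i))) -
      Sum_any (\<lambda>i. s ((-1) powi (a + 1) * ((of_int (- a - 1) gchoose i) * (-1) ^ i))
        (I w1 (Y2 v w2 (b - int i)) (c + of_int (a + 1 + int i)))) =
      Sum_any (\<lambda>i. s ((of_int (b + int i) gchoose i) * (-1) ^ i)
        (I (Y1 v w1 (a - int i)) w2 (c + of_int (b + 1 + int i)))))"
proof -
  interpret vector_space s by fact
  have 1: "ser_mult s delta_12_0 (\<lambda>a b c. if a = 0 then Y3 v (I w1 w2 c) b else 0) a b c =
      Sum_any (\<lambda>i. s ((of_int (- a - 1) gchoose i) * (-1) ^ i)
        (Y3 v (I w1 w2 (c - of_nat i)) (b + a + 1 + int i)))" for v w1 w2 a b c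
    unfolding ser_mult_def delta_12_0_def binom_diff_def
  proof (subst Sum_any_reindex_inj[where h="\<lambda>i. (a, - a - 1 - int i, int i)"])
    fix x assume "x \<notin> range (\<lambda>i. (a, - a - 1 - int i, int i))"
    moreover obtain a' b' c' where x: "x = (a', b', c')" by (cases x)
    ultimately have "\<not> (a' = a \<and> 0 \<le> c' \<and> b' + c' = - a' - 1)"
      by (auto simp: image_iff dest!: spec[of _ "nat c'"])
    then show "(case x of (a', b', c') \<Rightarrow>
        s (if 0 \<le> c' \<and> b' + c' = - a' - 1 then (of_int (- a' - 1) gchoose nat c') * (- 1) ^ nat c' else 0)
         (if a - a' = 0 then Y3 v (I w1 w2 (c - of_int c')) (b - b') else 0)) = 0"
      by (auto simp: x)
  next
    show "inj (\<lambda>i. (a, - a - 1 - int i, int i))" by (auto intro!: injI)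
  qed (simp add: algebra_simps)
  have 2: "ser_mult s delta_21_0 (\<lambda>a b c. if a = 0 then I w1 (Y2 v w2 b) c else 0) a b c =
      Sum_any (\<lambda>i. s ((-1) powi (a + 1) * ((of_int (- a - 1) gchoose i) * (-1) ^ i))
        (I w1 (Y2 v w2 (b - int i)) (c + of_int (a + 1 + int i))))" for v w1 w2 a b c
    unfolding ser_mult_def delta_21_0_def binom_diff_def
  proof (subst Sum_any_reindex_inj[where h="\<lambda>i. (a, int i, - a - 1 - int i)"])
    fix x assume "x \<notin> range (\<lambda>i. (a, int i, - a - 1 - int i))"
    moreover obtain a' b' c' where x: "x = (a', b', c')" by (cases x)
    ultimately have "\<not> (a' = a \<and> 0 \<le> b' \<and> c' + b' = - a' - 1)"
      by (auto simp: image_iff dest!: spec[of _ "nat b'"])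
    then show "(case x of (a', b', c') \<Rightarrow>
        s ((-1) powi (a' + 1) * (if 0 \<le> b' \<and> c' + b' = - a' - 1 then (of_int (- a' - 1) gchoose nat b') * (- 1) ^ nat b' else 0))
         (if a - a' = 0 then I w1 (Y2 v w2 (b - b')) (c - of_int c') else 0)) = 0"
      by (auto simp: x)
  next
    show "inj (\<lambda>i. (a, int i, - a - 1 - int i))" by (auto intro!: injI)
  qed (simp add: algebra_simps)
  have 3: "ser_mult s delta_10_2 (\<lambda>a b c. if b = 0 then I (Y1 v w1 a) w2 c else 0) a b c =
      Sum_any (\<lambda>i. s ((of_int (b + int i) gchoose i) * (-1) ^ i)
        (I (Y1 v w1 (a - int i)) w2 (c + of_int (b + 1 + int i))))" for v w1 w2 a b c
    unfolding ser_mult_def delta_10_2_def binom_diff_def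
  proof (subst Sum_any_reindex_inj[where h="\<lambda>i. (int i, b, - b - 1 - int i)"])
    fix x assume "x \<notin> range (\<lambda>i. (int i, b, - b - 1 - int i))"
    moreover obtain a' b' c' where x: "x = (a', b', c')" by (cases x)
    ultimately have "\<not> (b' = b \<and> 0 \<le> a' \<and> b' + a' = - c' - 1)"
      by (auto simp: image_iff dest!: spec[of _ "nat a'"])
    then show "(case x of (a', b', c') \<Rightarrow>
        s (if 0 \<le> a' \<and> b' + a' = - c' - 1 then (of_int (- c' - 1) gchoose nat a') * (- 1) ^ nat a' else 0)
         (if b - b' = 0 then I (Y1 v w1 (a - a')) w2 (c - of_int c') else 0)) = 0"
      by (auto simp: x)
  next
    show "inj (\<lambda>i. (int i, b, - b - 1 - int i))" by (auto intro!: injI)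
  qed (simp add: algebra_simps)
  show ?thesis unfolding jacobi_identity_def 1 2 3 ..
qed

section \<open>Consequences of the module axioms\<close>

text \<open>Common ground of the Moebius and the conformal case: the facts about a module on which
  the skew-symmetry argument rests. \<open>D_bracket\<close> is the commutator formula for L(-1)
  with the derivative property already inserted.\<close>

locale sl2_vertex_module =
  fixes W :: "('v, 'w::ab_group_add) gmod"
  assumes vs: "vector_space (mscale W)"
    and sl2: "sl2_action (mscale W) (mL W)"
    and Y_hom: "module_hom (mscale W) (mscale W) (\<lambda>w. mY W v w n)"
    and Y_truncated: "\<exists>N. \<forall>i>N. mY W v w (n - int i) = 0"
    and D_bracket: "mL W (-1) (mY W v w n) - mY W v (mL W (-1) w) n =
      mscale W (of_int (n + 1)) (mY W v w (n + 1))"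

text \<open>Among the three brackets only that of L(1) and L(-1) can have a central term, and m^3 -
  m vanishes at m = 1.\<close>

lemma virasoro_imp_sl2_action:
  assumes "vector_space s" "virasoro_relations s c L" "\<And>n. Vector_Spaces.linear s s (L n)"
  shows "sl2_action s L"
proof -
  interpret vector_space s by fact
  note vir = assms(2)[unfolded virasoro_relations_def, rule_format]
  show ?thesis
    using vir[of 0 1] vir[of 0 "-1"] vir[of 1 "-1"] assms(3) by (simp add: sl2_action_def)
qed

text \<open>The Jacobi identity for \<omega>, whose mode 0 will be L(-1), read off at exponent -1 of
  both x_0 and x_1: there every binomial coefficient with i > 0 vanishes.\<close>

lemma conformal_D_bracket:
  assumes vs: "vector_space s"
    and jacobi: "jacobi_identity s (vY V) Y Y Y"
    and deriv: "Y (vY V \<omega> v (-1)) w = ddx s (Y v w)"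
  shows "Y \<omega> (Y v w n) (-1) - Y v (Y \<omega> w (-1)) n = s (of_int (n + 1)) (Y v w (n + 1))"
proof -
  interpret vector_space s by fact
  have J: "Sum_any (\<lambda>i. s ((of_int (- (-1) - 1) gchoose i) * (-1) ^ i)
        (Y \<omega> (Y v w (n - of_nat i)) (-1 + (-1) + 1 + int i))) -
      Sum_any (\<lambda>i. s ((-1) powi (-1 + 1) * ((of_int (- (-1) - 1) gchoose i) * (-1) ^ i))
        (Y v (Y \<omega> w (-1 - int i)) (n + of_int (-1 + 1 + int i)))) =
      Sum_any (\<lambda>i. s ((of_int (-1 + int i) gchoose i) * (-1) ^ i)
        (Y (vY V \<omega> v (-1 - int i)) w (n + of_int (-1 + 1 + int i))))"
    using jacobi unfolding jacobi_identity_iff[OF vs] by blast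
  have 0: "(0 gchoose m :: complex) = 0" if "m > 0" for m
    using that by (cases m) auto
  have 1: "(of_nat m - 1 gchoose m :: complex) = 0" if "m > 0" for m
    using that binomial_gbinomial[of "m - 1" m, where 'a=complex] by (simp add: of_nat_diff binomial_eq_0)
  show ?thesis
    using J
    by (subst (asm) (1 2 3) Sum_any_eq_sum_atMost[where N=0]) (simp_all add: 0 1 deriv ddx_def)
qed

lemma generalized_module_imp_sl2_vertex_module:
  fixes V :: "'v::ab_group_add va" and W :: "('v, 'w::ab_group_add) gmod"
  assumes "vertex_algebra V" "generalized_module V W"
  shows "sl2_vertex_module W"
proof -
  have ax: "generalized_module_axioms V W"
    using assms(2) unfolding generalized_module_def
    by (auto split: va_kind.splits dest: moebius_generalized_module.axioms conformal_generalized_module.axioms)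
  interpret generalized_module_axioms V W by (rule ax)
  interpret vector_space "mscale W" by (rule vector_space)
  have lin: "Vector_Spaces.linear (mscale W) (mscale W) (\<lambda>w. mY W v w n)" for v n
    using Y_bilinear by (simp add: bilinear_ser_def)
  have trunc: "\<exists>N. \<forall>i>N. mY W v w (n - int i) = 0" for v w n
  proof -
    obtain N where N: "\<And>m. m \<ge> N \<Longrightarrow> mY W v w (- m - 1) = 0"
      using Y_truncation[of v w] by (auto simp: mode_def)
    \<comment> \<open>The exponent n - i belongs to the mode i - n - 1, which is at least N for such
      i.\<close>
    have "mY W v w (n - int i) = 0" if "i > nat (N + n + 1)" for i
      using N[of "int i - n - 1"] that by (simp add: nat_less_iff)
    then show ?thesis by blast
  qed
  have "sl2_action (mscale W) (mL W) \<and> (\<forall>v w n. mL W (-1) (mY W v w n) - mY W v (mL W (-1) w) n =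
      mscale W (of_int (n + 1)) (mY W v w (n + 1)))"
  proof (cases "vkind V")
    case Moebius
    then interpret M: moebius_generalized_module V W
      using assms(2) by (simp add: generalized_module_def)
    \<comment> \<open>For j = -1 the bracket relation has the single term i = 0, which the
      derivative property rewrites.\<close>
    have "mL W (-1) (mY W v w n) - mY W v (mL W (-1) w) n =
        (\<Sum>i = 0..nat (- 1 + 1). mscale W (of_nat (nat (- 1 + 1) choose i)) (mY W (vL V (- 1 - int i) v) w (n - of_nat i)))"
      for v w n
      using M.bracket unfolding sl2_bracket_def by blast
    then show ?thesis using M.sl2 by (simp add: Y_derivative ddx_def)
  next
    case (Conformal \<omega> c)
    then interpret M: conformal_generalized_module V W \<omega> c
      using assms(2) by (simp add: generalized_module_def)
    interpret V: conformal_vertex_algebra V \<omega> c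
      using assms(1) Conformal by (simp add: vertex_algebra_def)
    have "mY W (vY V \<omega> v (-1)) w = ddx (mscale W) (mY W v w)" for v w
      using Y_derivative[of v w] by (simp add: V.L_def)
    then have "mY W \<omega> (mY W v w n) (-1) - mY W v (mY W \<omega> w (-1)) n =
        mscale W (of_int (n + 1)) (mY W v w (n + 1))" for v w n
      by (rule conformal_D_bracket[OF vector_space_axioms Y_jacobi])
    moreover have "Vector_Spaces.linear (mscale W) (mscale W) (mL W n)" for n
      using lin[of \<omega> "- n - 2"] by (simp add: M.L_def[abs_def])
    ultimately show ?thesis
      using virasoro_imp_sl2_action[OF vector_space_axioms M.virasoro] by (simp add: M.L_def)
  qed
  then show ?thesis
    using vector_space_axioms lin trunc
    unfolding sl2_vertex_module_def by (simp add: module_hom_iff_linear)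
qed

section \<open>Skew-symmetry\<close>

definition zeta :: "int \<Rightarrow> complex" where
  "zeta r = of_int (2 * r + 1) * of_real pi * \<i>"

lemma exp_zeta: "exp (zeta r) = -1"
  using exp_power_int[of "of_real pi * \<i>" "2 * r + 1"]
  by (simp add: zeta_def mult.assoc exp_pi_i power_int_minus_left_odd)

lemma zeta_reflect: "zeta (- r - 1) = - zeta r"
  by (simp add: zeta_def algebra_simps)

lemma gbinomial_reflect: "(x gchoose t) * (-1) ^ t = ((- x + of_nat t - 1) gchoose t :: complex)"
  by (subst gbinomial_negated_upper) (simp add: algebra_simps)

lemma sum_gbinomial_Vandermonde:
  "(\<Sum>i\<le>t. (x gchoose i) * (y gchoose (t - i))) = (x + y gchoose t :: complex)"
  using gbinomial_Vandermonde[of x y t] by (simp add: atLeast0AtMost)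

lemma Omega_eq_exp_xD:
  "Omega W3 r I w2 w1 = exp_xD (mscale W3) (mL W3 (-1)) (subst_exp (mscale W3) (zeta r) (I w1 w2))"
  by (simp add: Omega_def zeta_def)

locale sl2_intertwining_operator =
  W1: sl2_vertex_module W1 + W2: sl2_vertex_module W2 + W3: sl2_vertex_module W3 +
  log_intertwining_operator W1 W2 W3 I
  for W1 :: "('v, 'w1::ab_group_add) gmod"
    and W2 :: "('v, 'w2::ab_group_add) gmod"
    and W3 :: "('v, 'w3::ab_group_add) gmod"
    and I :: "('w1, 'w2, 'w3) log_op"
begin

abbreviation "s \<equiv> mscale W3"
abbreviation "D \<equiv> mL W3 (-1)"

sublocale S: endomorphism s D
  using W3.vs W3.sl2
  by (simp add: endomorphism_def endomorphism_axioms_def sl2_action_def module_hom_iff_linear)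

lemma truncated_log_I: "truncated_log (I w1 w2)"
  unfolding truncated_log_def
proof
  fix n
  obtain M :: nat where M: "\<And>m k. m \<ge> M \<Longrightarrow> mode (I w1 w2) (- n - 1 + of_nat m) k = 0"
    using truncation[of w1 w2 "- n - 1"] by blast
  have "I w1 w2 (n - of_nat m) k = 0" if "m > M" for m k
    using M[of m k] that by (simp add: mode_def algebra_simps)
  then show "\<exists>N. \<forall>m>N. \<forall>k. I w1 w2 (n - of_nat m) k = 0" by blast
qed

lemma I_add_left: "I (w1 + w1') w2 = (\<lambda>n k. I w1 w2 n k + I w1' w2 n k)"
  and I_scale_left: "I (mscale W1 c w1) w2 = (\<lambda>n k. s c (I w1 w2 n k))"
  and I_add_right: "I w1 (w2 + w2') = (\<lambda>n k. I w1 w2 n k + I w1 w2' n k)"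
  and I_scale_right: "I w1 (mscale W2 c w2) = (\<lambda>n k. s c (I w1 w2 n k))"
  using bilinear by (auto simp: bilinear_ser_def Vector_Spaces.linear_iff fun_eq_iff)

lemma I_zero_left: "I 0 w2 n k = 0" and I_zero_right: "I w1 0 n k = 0"
  using I_add_left[of 0 0 w2] I_add_right[of w1 0 0] by (simp_all add: fun_eq_iff)

text \<open>A common bound makes the three sums finite; in this form the substitution and linear
  combinations can act termwise.\<close>

lemma jacobi_sum:
  assumes N: "\<And>m j. m > N \<Longrightarrow> I w1 w2 (n - of_nat m) j = 0"
    and N2: "\<And>i. i > N \<Longrightarrow> mY W2 v w2 (b - int i) = 0"
    and N1: "\<And>i. i > N \<Longrightarrow> mY W1 v w1 (a - int i) = 0"
  shows "(\<Sum>i\<le>N. s ((of_int (- a - 1) gchoose i) * (-1) ^ i)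
        (mY W3 v (I w1 w2 (n - of_nat i) k) (b + a + 1 + int i))) -
      (\<Sum>i\<le>N. s ((-1) powi (a + 1) * ((of_int (- a - 1) gchoose i) * (-1) ^ i))
        (I w1 (mY W2 v w2 (b - int i)) (n + of_int (a + 1 + int i)) k)) =
      (\<Sum>i\<le>N. s ((of_int (b + int i) gchoose i) * (-1) ^ i)
        (I (mY W1 v w1 (a - int i)) w2 (n + of_int (b + 1 + int i)) k))"
proof -
  note jacobi[of k, unfolded jacobi_identity_iff[OF W3.vs], rule_format, of a v w1 w2 n b]
  then show ?thesis
    by (subst (asm) (1 2 3) Sum_any_eq_sum_atMost[where N=N])
      (simp_all add: N N1 N2 I_zero_left I_zero_right module_hom.zero[OF W3.Y_hom])
qed

end

locale skew_intertwining_operator = sl2_intertwining_operator W1 W2 W3 I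
  for W1 :: "('v, 'w1::ab_group_add) gmod"
    and W2 :: "('v, 'w2::ab_group_add) gmod"
    and W3 :: "('v, 'w3::ab_group_add) gmod"
    and I :: "('w1, 'w2, 'w3) log_op" +
  fixes r :: int
begin

definition J :: "'w1 \<Rightarrow> 'w2 \<Rightarrow> 'w3 log_ser" where
  "J w1 w2 = subst_exp s (zeta r) (I w1 w2)"

abbreviation \<Omega> :: "'w2 \<Rightarrow> 'w1 \<Rightarrow> 'w3 log_ser" where
  "\<Omega> \<equiv> Omega W3 r I"

abbreviation E :: "(complex \<Rightarrow> 'w3) \<Rightarrow> complex \<Rightarrow> 'w3" where
  "E \<equiv> exp_ser s D 1"

lemma Omega_eq: "\<Omega> w2 w1 = (\<lambda>n k. E (\<lambda>n. J w1 w2 n k) n)"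
  by (intro ext) (simp add: Omega_eq_exp_xD J_def S.exp_xD_eq)

lemma truncated_log_J: "truncated_log (J w1 w2)"
  unfolding J_def by (intro truncated_log_subst_exp W3.vs truncated_log_I)

lemma truncated_J: "truncated (\<lambda>n. J w1 w2 n k)"
  by (intro truncated_log_imp_truncated truncated_log_J)

lemma log_series_J: "log_series (J w1 w2)"
  unfolding J_def by (intro log_series_subst_exp W3.vs log_series)

lemma J_zero_left: "J 0 w2 n k = 0" and J_zero_right: "J w1 0 n k = 0"
  by (simp_all add: J_def subst_exp_eq_0[OF W3.vs] I_zero_left I_zero_right)

lemma exp_zeta_shift: "exp (zeta r * (n + of_int m)) = exp (zeta r * n) * (-1) powi m"
  by (rule exp_shift_minus_one[OF exp_zeta])

lemma exp_zeta_shift_nat: "exp (zeta r * (n - of_nat i)) = exp (zeta r * n) * (-1) ^ i"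
  using exp_zeta_shift[of n "- int i"] by (simp add: power_int_minus power_inverse[symmetric])

section \<open>Formal properties of the skew operator\<close>

lemma log_series_Omega: "log_series (\<Omega> w2 w1)"
  unfolding Omega_eq by (intro S.log_series_exp_ser truncated_log_J log_series_J)

lemma truncation_Omega: "\<exists>M::nat. \<forall>m\<ge>M. \<forall>k. mode (\<Omega> w2 w1) (n + of_nat m) k = 0"
proof -
  have "truncated_log (\<Omega> w2 w1)"
    unfolding Omega_eq by (intro S.truncated_log_exp_ser truncated_log_J)
  then obtain N where "\<And>m k. m > N \<Longrightarrow> \<Omega> w2 w1 (- n - 1 - of_nat m) k = 0"
    using truncated_logE[where n="- n - 1"] by blast
  then have "\<forall>m\<ge>Suc N. \<forall>k. mode (\<Omega> w2 w1) (n + of_nat m) k = 0"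
    by (simp add: mode_def algebra_simps)
  then show ?thesis by blast
qed

lemma bilinear_Omega: "bilinear_ser (mscale W2) (mscale W1) s (\<lambda>w2 w1 n. \<Omega> w2 w1 n k)"
  using W1.vs W2.vs W3.vs
  by (simp add: bilinear_ser_def Vector_Spaces.linear_iff Omega_eq J_def I_add_left I_add_right
      I_scale_left I_scale_right subst_exp_add[OF W3.vs] subst_exp_scale[OF W3.vs] log_series
      S.exp_ser_add S.exp_ser_scale truncated_J[unfolded J_def])

text \<open>Compared with the axioms of \<open>I\<close>, the signs come from the substitution \<open>x \<mapsto> -x\<close>.\<close>

lemma J_bracket:
  assumes "j \<in> {-1, 0, 1}"
  shows "mL W3 j (J w1 w2 n k) = J w1 (mL W2 j w2) n k +
    (\<Sum>i = 0..nat (j + 1). s (of_nat (nat (j + 1) choose i) * (-1) ^ i)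
      (J (mL W1 (j - int i) w1) w2 (n - of_nat i) k))"
proof -
  have hom: "module_hom s s (mL W3 j)"
    using W3.sl2 assms by (auto simp: sl2_action_def module_hom_iff_linear)
  let ?c = "\<lambda>j. exp (zeta r * n) * of_nat (j choose k) * zeta r ^ (j - k)"
  have 1: "\<forall>\<^sub>F M in sequentially. (\<Sum>i\<in>{()}. mL W3 j (subst_exp s (zeta r) (I w1 w2) n k)) =
    (\<Sum>l\<le>M. s (?c l) (\<Sum>i\<in>{()}. s 1 (mL W3 j (I w1 w2 n l))))"
    by (rule subst_exp_linear_combination[OF W3.vs]) (auto simp: hom log_series)
  have 2: "\<forall>\<^sub>F M in sequentially. (\<Sum>i\<in>{()}. subst_exp s (zeta r) (I w1 (mL W2 j w2)) n k) =
    (\<Sum>l\<le>M. s (?c l) (\<Sum>i\<in>{()}. s 1 (I w1 (mL W2 j w2) n l)))"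
    by (rule subst_exp_linear_combination[OF W3.vs]) (auto simp: S.id_hom log_series)
  have 3: "\<forall>\<^sub>F M in sequentially. (\<Sum>i\<in>{0..nat (j + 1)}. s (of_nat (nat (j + 1) choose i) * (-1) ^ i)
      (subst_exp s (zeta r) (I (mL W1 (j - int i) w1) w2) (n - of_nat i) k)) =
    (\<Sum>l\<le>M. s (?c l) (\<Sum>i\<in>{0..nat (j + 1)}. s ((-1) ^ i)
      (s (of_nat (nat (j + 1) choose i) * (-1) ^ i) (I (mL W1 (j - int i) w1) w2 (n - of_nat i) l))))"
    by (rule subst_exp_linear_combination[OF W3.vs])
      (auto intro!: S.scale_comp_hom[OF S.id_hom] simp: log_series exp_zeta_shift_nat)
  have br: "mL W3 j (I w1 w2 n l) = I w1 (mL W2 j w2) n l +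
      (\<Sum>i = 0..nat (j + 1). s (of_nat (nat (j + 1) choose i)) (I (mL W1 (j - int i) w1) w2 (n - of_nat i) l))" for l
    using bracket[of l, unfolded sl2_bracket_def, rule_format, OF assms, of w1 w2 n]
    by (simp only: diff_eq_eq add.commute)
  \<comment> \<open>The three expansions hold for all large M and the claim does not mention M, so
    proving it for all large M suffices.\<close>
  have "\<forall>\<^sub>F M::nat in sequentially. ?thesis"
    using 1 2 3
  proof eventually_elim
    case (elim M)
    have sgn: "(-1) ^ i * (c * (-1) ^ i) = (c :: complex)" for c and i :: nat
      by (cases "even i") auto
    have e1: "mL W3 j (subst_exp s (zeta r) (I w1 w2) n k) = (\<Sum>l\<le>M. s (?c l) (mL W3 j (I w1 w2 n l)))"
      using elim(1) by (simp only: sum.insert sum.empty finite.emptyI empty_iff add_0_right S.scale_one simp_thms)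
    have e2: "subst_exp s (zeta r) (I w1 (mL W2 j w2)) n k = (\<Sum>l\<le>M. s (?c l) (I w1 (mL W2 j w2) n l))"
      using elim(2) by (simp only: sum.insert sum.empty finite.emptyI empty_iff add_0_right S.scale_one simp_thms)
    show ?case
      unfolding J_def e1 e2 elim(3) br S.scale_right_distrib sum.distrib S.scale_scale[of "(-1) ^ _"] sgn ..
  qed
  then show ?thesis by simp
qed

lemma J_derivative:
  "ddx_log s (J w1 w2) n k = - J (mL W1 (-1) w1) w2 n k"
  unfolding J_def derivative by (simp add: ddx_log_subst_exp[OF W3.vs log_series] exp_zeta)

text \<open>Under x -> -x the coefficient at exponent n + m acquires the sign (-1)^m. These signs
  absorb those of the first two delta functions and leave (-1)^(b + 1) in the third term, which is
  the sign of a second term once the exponents of x_0 and x_1 are interchanged.\<close>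

lemma J_jacobi:
  assumes N: "\<And>m j. m > N \<Longrightarrow> I w1 w2 (n - of_nat m) j = 0"
    and N2: "\<And>i. i > N \<Longrightarrow> mY W2 v w2 (b - int i) = 0"
    and N1: "\<And>i. i > N \<Longrightarrow> mY W1 v w1 (a - int i) = 0"
  shows "(\<Sum>i\<le>N. s (of_int (- a - 1) gchoose i) (mY W3 v (J w1 w2 (n - of_nat i) k) (b + a + 1 + int i))) -
    (\<Sum>i\<le>N. s (of_int (- a - 1) gchoose i) (J w1 (mY W2 v w2 (b - int i)) (n + of_int (a + 1 + int i)) k)) =
    (\<Sum>i\<le>N. s ((-1) powi (b + 1) * (of_int (b + int i) gchoose i))
      (J (mY W1 v w1 (a - int i)) w2 (n + of_int (b + 1 + int i)) k))"
proof -
  let ?c = "\<lambda>j. exp (zeta r * n) * of_nat (j choose k) * zeta r ^ (j - k)"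
  have 1: "\<forall>\<^sub>F M in sequentially. (\<Sum>i\<in>{..N}. s (of_int (- a - 1) gchoose i)
      (mY W3 v (subst_exp s (zeta r) (I w1 w2) (n - of_nat i) k) (b + a + 1 + int i))) =
    (\<Sum>l\<le>M. s (?c l) (\<Sum>i\<in>{..N}. s ((-1) ^ i) (s (of_int (- a - 1) gchoose i)
      (mY W3 v (I w1 w2 (n - of_nat i) l) (b + a + 1 + int i)))))"
    by (rule subst_exp_linear_combination[OF W3.vs])
      (auto intro!: S.scale_comp_hom W3.Y_hom simp: log_series exp_zeta_shift_nat)
  have 2: "\<forall>\<^sub>F M in sequentially. (\<Sum>i\<in>{..N}. s (of_int (- a - 1) gchoose i)
      (subst_exp s (zeta r) (I w1 (mY W2 v w2 (b - int i))) (n + of_int (a + 1 + int i)) k)) =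
    (\<Sum>l\<le>M. s (?c l) (\<Sum>i\<in>{..N}. s ((-1) powi (a + 1 + int i)) (s (of_int (- a - 1) gchoose i)
      (I w1 (mY W2 v w2 (b - int i)) (n + of_int (a + 1 + int i)) l))))"
    by (rule subst_exp_linear_combination[OF W3.vs])
      (auto intro!: S.scale_comp_hom[OF S.id_hom] exp_zeta_shift simp: log_series simp del: of_int_add of_int_1 of_int_of_nat_eq)
  have 3: "\<forall>\<^sub>F M in sequentially. (\<Sum>i\<in>{..N}. s ((-1) powi (b + 1) * (of_int (b + int i) gchoose i))
      (subst_exp s (zeta r) (I (mY W1 v w1 (a - int i)) w2) (n + of_int (b + 1 + int i)) k)) =
    (\<Sum>l\<le>M. s (?c l) (\<Sum>i\<in>{..N}. s ((-1) powi (b + 1 + int i)) (s ((-1) powi (b + 1) * (of_int (b + int i) gchoose i))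
      (I (mY W1 v w1 (a - int i)) w2 (n + of_int (b + 1 + int i)) l))))"
    by (rule subst_exp_linear_combination[OF W3.vs])
      (auto intro!: S.scale_comp_hom[OF S.id_hom] exp_zeta_shift simp: log_series simp del: of_int_add of_int_1 of_int_of_nat_eq)
  note jac = jacobi_sum[OF N N2 N1]
  have sgn: "(-1) powi (m + int i) = (-1) powi m * (-1 :: complex) ^ i" for m i
    by (simp add: power_int_add)
  have sgn2: "(-1) powi m * (-1) powi m = (1 :: complex)" for m
    by (cases "even m") (auto simp: power_int_minus_left_even power_int_minus_left_odd)
  have "\<forall>\<^sub>F M::nat in sequentially. ?thesis"
    using 1 2 3
  proof eventually_elim
    case (elim M)
    have jac': "(\<Sum>i\<in>{..N}. s ((-1) ^ i) (s (of_int (- a - 1) gchoose i)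
        (mY W3 v (I w1 w2 (n - of_nat i) l) (b + a + 1 + int i)))) -
      (\<Sum>i\<in>{..N}. s ((-1) powi (a + 1 + int i)) (s (of_int (- a - 1) gchoose i)
        (I w1 (mY W2 v w2 (b - int i)) (n + of_int (a + 1 + int i)) l))) =
      (\<Sum>i\<in>{..N}. s ((-1) powi (b + 1 + int i)) (s ((-1) powi (b + 1) * (of_int (b + int i) gchoose i))
        (I (mY W1 v w1 (a - int i)) w2 (n + of_int (b + 1 + int i)) l)))" for l
    proof -
      have "(-1) powi (a + 1 + int i) * x = (-1) powi (a + 1) * (x * (-1) ^ i)"
        and "(-1) powi (b + 1 + int i) * ((-1) powi (b + 1) * x) = x * (-1) ^ i"
        and "(-1) ^ i * x = x * (-1) ^ i"
        for i and x :: complex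
        by (simp_all only: sgn mult.assoc mult.commute mult.left_commute sgn2 mult_1_right mult_1_left)
      then show ?thesis using jac[where k=l] by (simp only: S.scale_scale)
    qed
    show ?case
      unfolding J_def elim jac'[symmetric] S.scale_right_diff_distrib sum_subtractf by (rule refl)
  qed
  then show ?thesis by simp
qed


section \<open>The Jacobi identity for the skew operator\<close>

lemma Omega_shift: "\<Omega> w2 w1 (n + x) k = E (\<lambda>n. J w1 w2 (n + x) k) n"
  by (simp add: Omega_eq S.exp_ser_shift[of 1 "\<lambda>n. J w1 w2 n k"])

lemma E_cong:
  assumes "\<And>i. f (n - of_nat i) = g (n - of_nat i)"
  shows "E f n = E g n"
  using assms by (rule S.exp_ser_cong)

text \<open>Moving e^(xD) to the left replaces x_1 by x_1 - x in the vertex operator. The expansion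
  of the delta function and that of x_1 - x are then merged by Vandermonde's identity, which
  interchanges the roles of a and b.\<close>

lemma E_Y_Omega:
  assumes N: "\<And>m k. m > N \<Longrightarrow> J w1 w2 (c - of_nat m) k = 0"
  shows "(\<Sum>i\<le>N. s ((of_int (- a - 1) gchoose i) * (-1) ^ i)
      (mY W3 v (\<Omega> w2 w1 (c - of_nat i) k) (b + a + 1 + int i))) =
    E (\<lambda>n. \<Sum>i\<le>N. s (of_int (- b - 1) gchoose i)
      (mY W3 v (J w1 w2 (n - of_nat i) k) (a + b + 1 + int i))) c"
proof -
  define h where "h t n = mY W3 v (J w1 w2 n k) (b + a + 1 + int t)" for t n
  \<comment> \<open>The coefficient of x_1^b' x^q in Y(v, x_1 - x) w, where b' stands for
    \<open>b'\<close>.\<close>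
  define B where "B b' q w = s ((of_int (b' + int q) gchoose q) * (-1) ^ q) (mY W3 v w (b' + int q))" for b' q w
  have h: "truncated (h t)" for t
    unfolding h_def by (rule S.truncated_hom[OF truncated_J W3.Y_hom])
  have h0: "E (h t) (c - of_nat t) = 0" if "t > N" for t
    using N[of "t + _"] that
    by (intro S.exp_ser_eq_0) (simp add: h_def diff_diff_eq module_hom.zero[OF W3.Y_hom])
  have B_hom: "module_hom s s (B b' q)" for b' q
    unfolding B_def by (intro S.scale_comp_hom W3.Y_hom)
  have B: "B b' q (D w) = D (B b' q w) + s (of_nat (Suc q)) (B b' (Suc q) w)" for b' q w
  proof -
    let ?y = "of_int (b' + int q) :: complex"
    \<comment> \<open>The commutator with D brings in the factor ?y + 1; absorption trades it for
      raising the lower index of the binomial coefficient.\<close>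
    have absorb: "of_nat (Suc q) * (?y + 1 gchoose Suc q) = (?y gchoose q) * (?y + 1)"
      by (simp only: Suc_times_gbinomial mult.commute)
    have "s (of_nat (Suc q)) (B b' (Suc q) w) =
        s (of_nat (Suc q) * (?y + 1 gchoose Suc q) * (-1) ^ Suc q) (mY W3 v w (b' + int q + 1))"
    proof -
      have "(of_int (b' + int (Suc q)) :: complex) = ?y + 1" and "b' + int (Suc q) = b' + int q + 1"
        by simp_all
      then show ?thesis by (simp only: B_def S.scale_scale mult.assoc)
    qed
    also have "\<dots> = - s ((?y gchoose q) * (-1) ^ q) (s (?y + 1) (mY W3 v w (b' + int q + 1)))"
      unfolding absorb by (simp add: mult_ac)
    also have "s (?y + 1) (mY W3 v w (b' + int q + 1)) =
        D (mY W3 v w (b' + int q)) - mY W3 v (D w) (b' + int q)"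
      using W3.D_bracket[of v w "b' + int q"] by simp
    finally show ?thesis
      by (simp add: B_def S.D_simps S.scale_right_diff_distrib)
  qed
  have Y_Omega: "mY W3 v (\<Omega> w2 w1 (c - of_nat i) k) b' =
      (\<Sum>q\<le>N. s ((of_int (b' + int q) gchoose q) * (-1) ^ q) (E (h (i + q)) (c - of_nat (i + q))))"
    if "b' = b + a + 1 + int i" for i b'
  proof -
    have "mY W3 v (\<Omega> w2 w1 (c - of_nat i) k) b' = B b' 0 (E (\<lambda>n. J w1 w2 n k) (c - of_nat i))"
      by (simp add: B_def Omega_eq)
    also have "\<dots> = (\<Sum>q\<le>N. E (\<lambda>n. B b' q (J w1 w2 n k)) (c - of_nat i - of_nat q))"
      by (rule S.exp_ser_conjugate[where B="B b'", OF B B_hom])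
        (use N[of "i + _"] in \<open>simp add: diff_diff_eq\<close>)
    also have "\<dots> = (\<Sum>q\<le>N. s ((of_int (b' + int q) gchoose q) * (-1) ^ q) (E (h (i + q)) (c - of_nat (i + q))))"
    proof (intro sum.cong refl)
      fix q
      have "(\<lambda>n. B b' q (J w1 w2 n k)) = (\<lambda>n. s ((of_int (b' + int q) gchoose q) * (-1) ^ q) (h (i + q) n))"
        by (simp add: B_def h_def that add.assoc)
      then show "E (\<lambda>n. B b' q (J w1 w2 n k)) (c - of_nat i - of_nat q) =
          s ((of_int (b' + int q) gchoose q) * (-1) ^ q) (E (h (i + q)) (c - of_nat (i + q)))"
        by (simp only: S.exp_ser_scale[OF h] diff_diff_eq of_nat_add)
    qed
    finally show ?thesis .
  qed
  \<comment> \<open>The vector depends on i + q alone, so regrouping by t = i + q leaves only a sum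
    of products of binomial coefficients.\<close>
  define X where "X i q = s ((of_int (- a - 1) gchoose i) * (of_int (b + a + 1 + int (i + q)) gchoose q) * (-1) ^ (i + q))
      (E (h (i + q)) (c - of_nat (i + q)))" for i q
  have "(\<Sum>i\<le>N. s ((of_int (- a - 1) gchoose i) * (-1) ^ i)
      (mY W3 v (\<Omega> w2 w1 (c - of_nat i) k) (b + a + 1 + int i))) = (\<Sum>i\<le>N. \<Sum>q\<le>N. X i q)"
    unfolding Y_Omega[OF refl] X_def S.scale_sum_right S.scale_scale
    by (simp add: power_add mult_ac add.assoc)
  also have "\<dots> = (\<Sum>t\<le>N. \<Sum>i\<le>t. X i (t - i))"
    by (rule sum_square_eq_sum_triangle) (simp add: X_def h0 del: of_nat_add)
  also have "\<dots> = (\<Sum>t\<le>N. s (of_int (- b - 1) gchoose t) (E (h t) (c - of_nat t)))"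
  proof (intro sum.cong refl)
    fix t
    have "(\<Sum>i\<le>t. X i (t - i)) = s ((\<Sum>i\<le>t. (of_int (- a - 1) gchoose i) *
        (of_int (b + a + 1 + int t) gchoose (t - i))) * (-1) ^ t) (E (h t) (c - of_nat t))"
      by (simp add: X_def S.scale_sum_left sum_distrib_right)
    \<comment> \<open>The upper arguments add up to b + t, from which a has disappeared. Reflection
      then gives (-b - 1 choose t), the coefficient with b in place of a.\<close>
    also have "(\<Sum>i\<le>t. (of_int (- a - 1) gchoose i) * (of_int (b + a + 1 + int t) gchoose (t - i))) =
        (of_int b + of_nat t gchoose t :: complex)"
      unfolding sum_gbinomial_Vandermonde by simp
    also have "(of_int b + of_nat t gchoose t) * (-1) ^ t = (of_int (- b - 1) gchoose t :: complex)"
      by (simp add: gbinomial_reflect)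
    finally show "(\<Sum>i\<le>t. X i (t - i)) = s (of_int (- b - 1) gchoose t) (E (h t) (c - of_nat t))" .
  qed
  also have "\<dots> = (\<Sum>t\<le>N. s (of_int (- b - 1) gchoose t) (E (\<lambda>n. h t (n - of_nat t)) c))"
    using S.exp_ser_shift[where x="- of_nat _"] by simp
  also have "\<dots> = E (\<lambda>n. \<Sum>t\<le>N. s (of_int (- b - 1) gchoose t) (h t (n - of_nat t))) c"
    using S.truncated_shift[OF h, where x="- of_nat _"] by (simp add: S.exp_ser_sum)
  finally show ?thesis by (simp add: h_def add.commute)
qed

text \<open>The three terms are E applied to \<open>T1\<close>, \<open>T3\<close> and
  \<open>T2\<close>, the terms of the identity for J with a and b interchanged. Exchanging the two
  modules swaps the second and third terms.\<close>

lemma jacobi_Omega: "jacobi_identity s (mY W2) (mY W1) (mY W3) (\<lambda>w2 w1 n. \<Omega> w2 w1 n k)"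
  unfolding jacobi_identity_iff[OF W3.vs]
proof (intro allI)
  fix v w2 w1 a b and c :: complex
  obtain K where K: "\<And>m k. m > K \<Longrightarrow> I w1 w2 (c - of_nat m) k = 0"
    using truncated_logE[OF truncated_log_I, where n=c] by blast
  obtain K1 where K1: "\<And>i. i > K1 \<Longrightarrow> mY W1 v w1 (b - int i) = 0" using W1.Y_truncated by blast
  obtain K2 where K2: "\<And>i. i > K2 \<Longrightarrow> mY W2 v w2 (a - int i) = 0" using W2.Y_truncated by blast
  define N where "N = max K (max K1 K2)"
  have NI: "I w1 w2 (c - of_nat m) k = 0" if "m > N" for m k using K that by (simp add: N_def)
  have NJ: "J w1 w2 (c - of_nat m) k = 0" if "m > N" for m k
    using NI[OF that] by (simp add: J_def subst_exp_eq_0[OF W3.vs])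
  have N1: "mY W1 v w1 (b - int i) = 0" if "i > N" for i using K1 that by (simp add: N_def)
  have N2: "mY W2 v w2 (a - int i) = 0" if "i > N" for i using K2 that by (simp add: N_def)
  have Omega_0: "\<Omega> w2 w1 (c - of_nat m) k = 0" if "m > N" for m
    unfolding Omega_eq using NJ[of "m + _"] that by (intro S.exp_ser_eq_0) (simp add: diff_diff_eq)
  have Omega_zero: "\<Omega> w2 0 n k = 0" "\<Omega> 0 w1 n k = 0" for n w1 w2
    by (simp_all add: Omega_eq J_zero_left J_zero_right S.exp_ser_eq_0)
  define T1 where "T1 n = (\<Sum>i\<le>N. s (of_int (- b - 1) gchoose i)
      (mY W3 v (J w1 w2 (n - of_nat i) k) (a + b + 1 + int i)))" for n
  define T2 where "T2 n = (\<Sum>i\<le>N. s (of_int (- b - 1) gchoose i)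
      (J w1 (mY W2 v w2 (a - int i)) (n + of_int (b + 1 + int i)) k))" for n
  define T3 where "T3 n = (\<Sum>i\<le>N. s ((-1) powi (a + 1) * (of_int (a + int i) gchoose i))
      (J (mY W1 v w1 (b - int i)) w2 (n + of_int (a + 1 + int i)) k))" for n
  have shifted: "truncated (\<lambda>n. J u1 u2 (n + x) k)" for u1 u2 x
    by (rule S.truncated_shift[OF truncated_J])
  have T1: "truncated T1"
    unfolding T1_def using shifted[where x="- of_nat _"]
    by (intro S.truncated_sum S.truncated_hom[OF _ W3.Y_hom]) simp_all
  have T2: "truncated T2"
    unfolding T2_def by (intro S.truncated_sum shifted) simp
  \<comment> \<open>Needed at every c - p, since E at c draws on all these coefficients.\<close>
  have jac: "T1 (c - of_nat p) - T2 (c - of_nat p) = T3 (c - of_nat p)" for p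
    unfolding T1_def T2_def T3_def
    by (rule J_jacobi) (use NI[of "p + _"] N1 N2 in \<open>simp_all add: diff_diff_eq\<close>)
  have S1: "Sum_any (\<lambda>i. s ((of_int (- a - 1) gchoose i) * (-1) ^ i)
        (mY W3 v (\<Omega> w2 w1 (c - of_nat i) k) (b + a + 1 + int i))) = E T1 c"
    unfolding T1_def
    by (subst Sum_any_eq_sum_atMost[where N=N])
      (simp add: Omega_0 module_hom.zero[OF W3.Y_hom], rule E_Y_Omega[OF NJ])
  have S2: "Sum_any (\<lambda>i. s ((-1) powi (a + 1) * ((of_int (- a - 1) gchoose i) * (-1) ^ i))
        (\<Omega> w2 (mY W1 v w1 (b - int i)) (c + of_int (a + 1 + int i)) k)) = E T3 c"
    unfolding T3_def Omega_shift
    by (subst Sum_any_eq_sum_atMost[where N=N])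
      (simp_all add: N1 J_zero_left S.exp_ser_eq_0 S.exp_ser_sum shifted gbinomial_reflect)
  have S3: "Sum_any (\<lambda>i. s ((of_int (b + int i) gchoose i) * (-1) ^ i)
        (\<Omega> (mY W2 v w2 (a - int i)) w1 (c + of_int (b + 1 + int i)) k)) = E T2 c"
    unfolding T2_def Omega_shift
    by (subst Sum_any_eq_sum_atMost[where N=N])
      (simp_all add: N2 J_zero_right S.exp_ser_eq_0 S.exp_ser_sum shifted gbinomial_reflect)
  have "E T1 c - E T3 c = E T2 c"
    using S.exp_ser_diff[OF T1 T2, of 1 c] E_cong[of "\<lambda>n. T1 n - T2 n" c T3] jac
    by (simp add: algebra_simps)
  then show "Sum_any (\<lambda>i. s ((of_int (- a - 1) gchoose i) * (-1) ^ i)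
        (mY W3 v (\<Omega> w2 w1 (c - of_nat i) k) (b + a + 1 + int i))) -
      Sum_any (\<lambda>i. s ((-1) powi (a + 1) * ((of_int (- a - 1) gchoose i) * (-1) ^ i))
        (\<Omega> w2 (mY W1 v w1 (b - int i)) (c + of_int (a + 1 + int i)) k)) =
      Sum_any (\<lambda>i. s ((of_int (b + int i) gchoose i) * (-1) ^ i)
        (\<Omega> (mY W2 v w2 (a - int i)) w1 (c + of_int (b + 1 + int i)) k))"
    unfolding S1 S2 S3 .
qed

section \<open>The sl(2) relations for the skew operator\<close>

lemma E_L_J:
  assumes "j \<in> {-1, 0, 1}"
  shows "E (\<lambda>n. mL W3 j (J w1 w2 n k)) n = \<Omega> (mL W2 j w2) w1 n k +
    (\<Sum>i = 0..nat (j + 1). s (of_nat (nat (j + 1) choose i) * (-1) ^ i)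
      (\<Omega> w2 (mL W1 (j - int i) w1) (n - of_nat i) k))"
proof -
  have shifted: "truncated (\<lambda>n. J u1 u2 (n - of_nat i) k)" for u1 u2 i
    using S.truncated_shift[OF truncated_J, where x="- of_nat i"] by simp
  have "\<Omega> w2 (mL W1 (j - int i) w1) (n - of_nat i) k =
      E (\<lambda>n. J (mL W1 (j - int i) w1) w2 (n - of_nat i) k) n" for i
    using Omega_shift[where x="- of_nat i"] by simp
  then show ?thesis
    by (simp add: J_bracket[OF assms] S.exp_ser_add S.exp_ser_sum S.truncated_sum truncated_J shifted Omega_eq)
qed

text \<open>The bracket of L(0) with D is D, which commutes with D, so conjugation gives L(0) + x D
  and stops.\<close>

lemma L0_E:
  assumes "truncated f"
  shows "mL W3 0 (E f n) = E (\<lambda>n. mL W3 0 (f n)) n + E (\<lambda>n. D (f n)) (n - 1)"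
proof -
  define B where "B q = (if q = 0 then mL W3 0 else if q = 1 then D else (\<lambda>w. 0))" for q :: nat
  have L0: "module_hom s s (mL W3 0)"
    using W3.sl2 by (simp add: sl2_action_def module_hom_iff_linear)
  have "B q (D w) = D (B q w) + s (of_nat (Suc q)) (B (Suc q) w)" for q w
    using W3.sl2 by (simp add: B_def sl2_action_def S.D_simps algebra_simps)
  moreover have "module_hom s s (B q)" for q
    \<comment> \<open>The zero map enters as 0 times D.\<close>
    using L0 S.D_hom S.scale_comp_hom[OF S.D_hom, of 0] by (simp add: B_def)
  ultimately have "B 0 (E f n) = (\<Sum>q\<le>1. E (\<lambda>n. B q (f n)) (n - of_nat q))"
    by (rule S.exp_ser_conjugate_finite) (simp_all add: B_def assms)
  then show ?thesis by (simp add: B_def)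
qed

lemma L1_E:
  assumes "truncated f"
  shows "mL W3 1 (E f n) = E (\<lambda>n. mL W3 1 (f n)) n +
    (s 2 (E (\<lambda>n. mL W3 0 (f n)) (n - 1)) + E (\<lambda>n. D (f n)) (n - 2))"
proof -
  \<comment> \<open>The coefficients of L(1) + 2 x L(0) + x^2 D. The last is D rather than 2 D
    because the bracket of 2 L(0) with D has to equal twice the coefficient of x^2.\<close>
  define B where "B q = (if q = 0 then mL W3 1 else if q = 1 then (\<lambda>w. s 2 (mL W3 0 w))
      else if q = 2 then D else (\<lambda>w. 0))" for q :: nat
  have L: "module_hom s s (mL W3 0)" "module_hom s s (mL W3 1)"
    using W3.sl2 by (simp_all add: sl2_action_def module_hom_iff_linear)
  have "B q (D w) = D (B q w) + s (of_nat (Suc q)) (B (Suc q) w)" for q w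
  proof -
    consider "q = 0" | "q = 1" | "q = 2" | "q > 2" by linarith
    then show ?thesis
    proof cases
      case 2
      have "mL W3 0 (D w) = D (mL W3 0 w) + D w"
        using W3.sl2 by (simp add: sl2_action_def algebra_simps)
      then show ?thesis using 2 by (simp add: B_def S.D_simps S.scale_right_distrib)
    qed (use W3.sl2 in \<open>simp_all add: B_def sl2_action_def S.D_simps algebra_simps\<close>)
  qed
  moreover have "module_hom s s (B q)" for q
    using L S.D_hom S.scale_comp_hom[OF S.D_hom, of 0] S.scale_comp_hom[OF L(1), of 2] by (simp add: B_def)
  ultimately have "B 0 (E f n) = (\<Sum>q\<le>2. E (\<lambda>n. B q (f n)) (n - of_nat q))"
    by (rule S.exp_ser_conjugate_finite) (simp_all add: B_def assms)
  then show ?thesis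
    using S.truncated_hom[OF assms L(1)] by (simp add: B_def numeral_2_eq_2 S.exp_ser_scale)
qed

lemma D_E:
  assumes "truncated f"
  shows "D (E f n) = E (\<lambda>n. D (f n)) n"
proof -
  define B where "B q = (if q = 0 then D else (\<lambda>w. 0))" for q :: nat
  have "B q (D w) = D (B q w) + s (of_nat (Suc q)) (B (Suc q) w)" for q w
    by (simp add: B_def S.D_simps)
  moreover have "module_hom s s (B q)" for q
    using S.D_hom S.scale_comp_hom[OF S.D_hom, of 0] by (simp add: B_def)
  ultimately have "B 0 (E f n) = (\<Sum>q\<le>0. E (\<lambda>n. B q (f n)) (n - of_nat q))"
    by (rule S.exp_ser_conjugate_finite) (simp_all add: B_def assms)
  then show ?thesis by (simp add: B_def)
qed

text \<open>The corrections that act on \<open>w1\<close> in the relations for J have alternating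
  signs and cancel against those created by conjugation with e^(xD). What survives are the
  corrections acting on \<open>w2\<close>.\<close>

lemma bracket_Omega: "sl2_bracket s (mL W2) (mL W1) (mL W3) (\<lambda>w2 w1 n. \<Omega> w2 w1 n k)"
proof -
  have m: "E (\<lambda>n. D (J w1 w2 n k)) n =
      \<Omega> (mL W2 (-1) w2) w1 n k + \<Omega> w2 (mL W1 (-1) w1) n k" for w1 w2 n
    using E_L_J[of "-1"] by simp
  have z: "E (\<lambda>n. mL W3 0 (J w1 w2 n k)) n = \<Omega> (mL W2 0 w2) w1 n k +
      (\<Omega> w2 (mL W1 0 w1) n k - \<Omega> w2 (mL W1 (-1) w1) (n - 1) k)" for w1 w2 n
    using E_L_J[of 0] by simp
  have p: "E (\<lambda>n. mL W3 1 (J w1 w2 n k)) n = \<Omega> (mL W2 1 w2) w1 n k +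
      (\<Omega> w2 (mL W1 1 w1) n k - s 2 (\<Omega> w2 (mL W1 0 w1) (n - 1) k) +
       \<Omega> w2 (mL W1 (-1) w1) (n - 2) k)" for w1 w2 n
    using E_L_J[of 1] by (simp add: numeral_2_eq_2)
  have "D (\<Omega> w2 w1 n k) = \<Omega> (mL W2 (-1) w2) w1 n k + \<Omega> w2 (mL W1 (-1) w1) n k" for w1 w2 n
    using m by (simp add: Omega_eq D_E truncated_J)
  moreover have "mL W3 0 (\<Omega> w2 w1 n k) = \<Omega> w2 (mL W1 0 w1) n k +
      (\<Omega> (mL W2 0 w2) w1 n k + \<Omega> (mL W2 (-1) w2) w1 (n - 1) k)" for w1 w2 n
    using z[of w1 w2 n] m[of w1 w2 "n - 1"] L0_E[OF truncated_J, of w1 w2 k n] by (simp add: Omega_eq)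
  moreover have "mL W3 1 (\<Omega> w2 w1 n k) = \<Omega> w2 (mL W1 1 w1) n k +
      (\<Omega> (mL W2 1 w2) w1 n k + s 2 (\<Omega> (mL W2 0 w2) w1 (n - 1) k) +
       \<Omega> (mL W2 (-1) w2) w1 (n - 2) k)" for w1 w2 n
  proof -
    \<comment> \<open>Written as a sum so that the three contributions to this term, with
      coefficients 1, -2 and 1, visibly cancel.\<close>
    have "s 2 (\<Omega> w2 (mL W1 (-1) w1) (n - 2) k) =
        \<Omega> w2 (mL W1 (-1) w1) (n - 2) k + \<Omega> w2 (mL W1 (-1) w1) (n - 2) k"
      using S.scale_left_distrib[of 1 1] by simp
    then show ?thesis
      using p[of w1 w2 n] z[of w1 w2 "n - 1"] m[of w1 w2 "n - 2"] L1_E[OF truncated_J, of w1 w2 k n]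
      by (simp add: Omega_eq S.scale_right_distrib S.scale_right_diff_distrib)
  qed
  ultimately show ?thesis
    unfolding sl2_bracket_def by (simp add: numeral_2_eq_2)
qed

text \<open>The derivative of e^(xD) J is e^(xD) applied to J' + D J. The part of D J in which L(-1)
  acts on \<open>w1\<close> cancels J', because the substitution reversed the sign of the
  derivative.\<close>

lemma derivative_Omega: "\<Omega> (mL W2 (-1) w2) w1 = ddx_log s (\<Omega> w2 w1)"
proof (intro ext)
  fix n k
  have shifted: "truncated (\<lambda>n. J w1 w2 (n + 1) (k + 1))"
    by (rule S.truncated_shift[OF truncated_J])
  have DJ: "truncated (\<lambda>n. D (J w1 w2 n k))"
    by (rule S.truncated_hom[OF truncated_J S.D_hom])
  have "truncated (\<lambda>n. s (n + 1) (J w1 w2 (n + 1) k))"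
    using S.truncated_shift[OF truncated_J, where x=1] unfolding truncated_def
    by (metis S.scale_zero_right)
  then have sDJ: "truncated (\<lambda>n. s (n + 1) (J w1 w2 (n + 1) k) + D (J w1 w2 n k))"
    using DJ S.truncated_sum[of "UNIV :: bool set"
        "\<lambda>b. if b then (\<lambda>n. s (n + 1) (J w1 w2 (n + 1) k)) else (\<lambda>n. D (J w1 w2 n k))" "\<lambda>_. 1"]
    by (simp add: UNIV_bool add.commute)
  have "ddx_log s (\<Omega> w2 w1) n k = E (\<lambda>n. s (n + 1) (J w1 w2 (n + 1) k) + D (J w1 w2 n k)) n +
      s (of_nat (k + 1)) (E (\<lambda>n. J w1 w2 (n + 1) (k + 1)) n)"
    unfolding ddx_log_def Omega_shift[of _ _ n 1 "k + 1"]
    using S.exp_ser_ddx[OF truncated_J] by (simp add: Omega_eq)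
  also have "\<dots> = E (\<lambda>n. s (n + 1) (J w1 w2 (n + 1) k) + D (J w1 w2 n k) +
      s (of_nat (k + 1)) (J w1 w2 (n + 1) (k + 1))) n"
    using sDJ shifted S.truncated_hom[OF shifted S.scale_comp_hom[OF S.id_hom]]
    by (simp add: S.exp_ser_add S.exp_ser_scale)
  also have "\<dots> = E (\<lambda>n. ddx_log s (J w1 w2) n k + D (J w1 w2 n k)) n"
    by (simp add: ddx_log_def algebra_simps)
  also have "\<dots> = E (\<lambda>n. J w1 (mL W2 (-1) w2) n k) n"
    using J_bracket[of "-1"] by (simp add: J_derivative)
  finally show "\<Omega> (mL W2 (-1) w2) w1 n k = ddx_log s (\<Omega> w2 w1) n k"
    by (simp add: Omega_eq)
qed

section \<open>The axioms assembled, and the inverse correspondence\<close>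

theorem log_intertwining_operator_Omega: "log_intertwining_operator W2 W1 W3 \<Omega>"
  by unfold_locales
    (rule log_series_Omega bilinear_Omega truncation_Omega jacobi_Omega derivative_Omega bracket_Omega)+

theorem Omega_Omega: "Omega W3 (- r - 1) \<Omega> = I"
proof (intro ext)
  fix w1 w2 n k
  have "subst_exp s (- zeta r) (\<Omega> w2 w1) n k = exp_ser s D (-1) (\<lambda>n. I w1 w2 n k) n" for n
    using S.subst_exp_exp_ser[OF truncated_log_J log_series_J, of "- zeta r" 1]
    by (simp add: Omega_eq exp_minus exp_zeta J_def subst_exp_subst_exp[OF W3.vs log_series]
        subst_exp_0[OF W3.vs])
  then have "Omega W3 (- r - 1) \<Omega> w1 w2 n k = E (exp_ser s D (-1) (\<lambda>n. I w1 w2 n k)) n"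
    unfolding Omega_eq_exp_xD[of _ "- r - 1"] zeta_reflect S.exp_xD_eq by simp
  also have "\<dots> = I w1 w2 n k"
    by (simp add: S.exp_ser_exp_ser truncated_log_imp_truncated truncated_log_I S.exp_ser_0)
  finally show "Omega W3 (- r - 1) \<Omega> w1 w2 n k = I w1 w2 n k" .
qed

end

section \<open>Dimensions\<close>

text \<open>Any basis may replace the one selected by the choice operator, since two bases of the
  same space are equipotent.\<close>

lemma card_of_basis_ordIso_card_dim:
  fixes s :: "complex \<Rightarrow> 'a::ab_group_add \<Rightarrow> 'a"
  assumes "vector_space s" "\<not> module.dependent s B"
  shows "card_of B =o card_dim s (module.span s B)"
proof -
  interpret vector_space s by fact
  define C where "C = (SOME C. independent C \<and> span C = span B)"
  have "independent C \<and> span C = span B"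
    unfolding C_def by (rule someI[of _ B]) (use assms(2) in simp)
  then obtain g where "bij_betw g B C"
    using bij_if_span_eq_span_bases[of B C] assms(2) by auto
  then show ?thesis unfolding card_dim_def C_def[symmetric] by (rule card_of_ordIsoI)
qed

lemma linear_iso_on_imp_card_dim_ordIso:
  fixes s :: "complex \<Rightarrow> 'a::ab_group_add \<Rightarrow> 'a" and t :: "complex \<Rightarrow> 'b::ab_group_add \<Rightarrow> 'b"
  assumes vs: "vector_space s" "vector_space t" and iso: "linear_iso_on s t X X' f"
  shows "card_dim s X =o card_dim t X'"
proof -
  interpret S: vector_space s by (rule vs)
  interpret T: vector_space t by (rule vs)
  interpret P: vector_space_pair s t ..
  have X: "S.subspace X" and add: "\<And>x y. x \<in> X \<Longrightarrow> y \<in> X \<Longrightarrow> f (x + y) = f x + f y"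
    and scale: "\<And>c x. x \<in> X \<Longrightarrow> f (s c x) = t c (f x)" and bij: "bij_betw f X X'"
    using iso by (auto simp: linear_iso_on_def)
  obtain B where B: "B \<subseteq> X" "S.independent B" "X \<subseteq> S.span B"
    using S.maximal_independent_subset by blast
  have span: "S.span B = X"
    using B X by (simp add: S.span_minimal subset_antisym)
  \<comment> \<open>The map f is linear only on X. A globally linear g that agrees with f on a basis
    of X, hence on X, gives access to the facts about linear maps.\<close>
  obtain g where g: "Vector_Spaces.linear s t g" "\<forall>x\<in>B. g x = f x"
    using P.linear_independent_extend[OF B(2)] by blast
  interpret G: Vector_Spaces.linear s t g by (rule g(1))
  have "g x = f x \<and> x \<in> X" if "x \<in> S.span B" for x
    using that
  proof (induction rule: S.span_induct_alt)
    case base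
    then show ?case using scale[of 0 0] S.subspace_0[OF X] by simp
  next
    case (step c x y)
    then have "x \<in> X" using B(1) by auto
    then show ?case
      using step g(2) S.subspace_add[OF X S.subspace_scale[OF X]]
      by (simp add: add scale S.subspace_scale[OF X] G.add G.scale)
  qed
  then have gf: "g x = f x" if "x \<in> X" for x using that span by blast
  have inj: "inj_on g (S.span B)" and img: "g ` S.span B = X'"
    using bij gf unfolding span bij_betw_def by (auto simp: inj_on_def)
  have "T.independent (g ` B)" by (rule G.independent_injective_image[OF B(2) inj])
  moreover have "T.span (g ` B) = X'" using img by (simp add: G.span_image)
  ultimately have "card_of (g ` B) =o card_dim t X'"
    using card_of_basis_ordIso_card_dim[OF vs(2), of "g ` B"] by simp
  moreover have "card_of B =o card_of (g ` B)"
    using inj S.span_superset by (intro card_of_ordIsoI[of g]) (auto simp: bij_betw_def intro: inj_on_subset)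
  moreover have "card_of B =o card_dim s X"
    using card_of_basis_ordIso_card_dim[OF vs(1) B(2)] by (simp add: span)
  ultimately show ?thesis by (meson ordIso_symmetric ordIso_transitive)
qed

section \<open>Strongly graded modules\<close>

lemma subspace_Sum_any:
  assumes "vector_space s" "module.subspace s X" "\<And>i. g i \<in> X"
  shows "Sum_any g \<in> X"
proof -
  interpret vector_space s by fact
  show ?thesis unfolding Sum_any.expand_set by (rule subspace_sum[OF assms(2,3)])
qed

text \<open>Every coefficient is a finite combination of powers of D applied to coefficients of I,
  so it stays in the same graded subspace; the degrees commute.\<close>

lemma grading_compatible_Omega:
  assumes vs: "vector_space (mscale W3)"
    and sub: "\<And>\<beta>. module.subspace (mscale W3) (H3 \<beta>)"
    and D: "\<And>\<beta> w. w \<in> H3 \<beta> \<Longrightarrow> mL W3 (-1) w \<in> H3 \<beta>"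
    and I: "grading_compatible H1 H2 H3 I"
  shows "grading_compatible H2 H1 H3 (Omega W3 r I)"
  unfolding grading_compatible_def
proof (intro allI ballI)
  interpret vector_space "mscale W3" by (rule vs)
  fix \<gamma> \<beta> w2 w1 n k
  assume w: "w2 \<in> H2 \<gamma>" "w1 \<in> H1 \<beta>"
  have "mode (I w1 w2) (- n - 1) k \<in> H3 (\<beta> + \<gamma>)" for n k
    using I w unfolding grading_compatible_def by blast
  then have "I w1 w2 n k \<in> H3 (\<gamma> + \<beta>)" for n k
    by (simp add: mode_def add.commute)
  then have "subst_exp (mscale W3) (zeta r) (I w1 w2) n k \<in> H3 (\<gamma> + \<beta>)" for n k
    unfolding subst_exp_def by (intro subspace_Sum_any[OF vs sub] subspace_scale[OF sub])
  moreover have "(mL W3 (-1) ^^ i) w \<in> H3 \<alpha>" if "w \<in> H3 \<alpha>" for i w \<alpha>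
    using that by (induction i) (auto intro: D)
  ultimately show "mode (Omega W3 r I w2 w1) n k \<in> H3 (\<gamma> + \<beta>)"
    unfolding mode_def Omega_eq_exp_xD exp_xD_def
    by (intro subspace_Sum_any[OF vs sub] subspace_scale[OF sub]) blast
qed

section \<open>The vector space of intertwining operators\<close>

lemma sl2_bracket_linear:
  fixes F G :: "'w1 \<Rightarrow> 'w2 \<Rightarrow> 'e::ring_1 \<Rightarrow> 'w3::ab_group_add"
  assumes "vector_space s" "\<And>j. j \<in> {-1, 0, 1} \<Longrightarrow> module_hom s s (L3 j)"
    and "sl2_bracket s L1 L2 L3 F" "sl2_bracket s L1 L2 L3 G"
  shows "sl2_bracket s L1 L2 L3 (\<lambda>w1 w2 n. s a (F w1 w2 n) + s b (G w1 w2 n))"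
proof -
  interpret vector_space s by fact
  show ?thesis
    unfolding sl2_bracket_def
  proof (intro ballI allI)
    fix j :: int and w1 :: 'w1 and w2 :: 'w2 and n :: 'e
    assume j: "j \<in> {-1, 0, 1}"
    let ?R = "\<lambda>F. \<Sum>i = 0..nat (j + 1). s (of_nat (nat (j + 1) choose i)) (F (L1 (j - int i) w1) w2 (n - of_nat i))"
    have F: "L3 j (F w1 w2 n) = F w1 (L2 j w2) n + ?R F"
      and G: "L3 j (G w1 w2 n) = G w1 (L2 j w2) n + ?R G"
      using assms(3,4)[unfolded sl2_bracket_def, rule_format, OF j, of w1 w2 n]
      by (simp_all only: diff_eq_eq add.commute)
    show "L3 j (s a (F w1 w2 n) + s b (G w1 w2 n)) - (s a (F w1 (L2 j w2) n) + s b (G w1 (L2 j w2) n)) =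
        ?R (\<lambda>w1 w2 n. s a (F w1 w2 n) + s b (G w1 w2 n))"
      unfolding module_hom.add[OF assms(2)[OF j]] module_hom.scale[OF assms(2)[OF j]] F G
      by (simp add: scale_right_distrib sum.distrib scale_sum_right mult.commute)
  qed
qed

lemma log_intertwining_operator_0:
  assumes "sl2_vertex_module W1" "sl2_vertex_module W2" "sl2_vertex_module W3"
  shows "log_intertwining_operator W1 W2 W3 0"
proof -
  interpret W1: sl2_vertex_module W1 by fact
  interpret W2: sl2_vertex_module W2 by fact
  interpret W3: sl2_vertex_module W3 by fact
  interpret S: vector_space "mscale W3" by (rule W3.vs)
  have L0: "mL W3 j 0 = 0" if "j \<in> {-1, 0, 1}" for j
    using W3.sl2 that
    by (auto simp: sl2_action_def module_hom_iff_linear[symmetric] intro: module_hom.zero)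
  show ?thesis
    using W1.vs W2.vs W3.vs L0
    by unfold_locales
      (auto simp: log_series_def bilinear_ser_def Vector_Spaces.linear_iff mode_def
        jacobi_identity_iff[OF W3.vs] module_hom.zero[OF W3.Y_hom] ddx_log_def fun_eq_iff sl2_bracket_def)
qed

text \<open>Serves both closure properties of a subspace: x = y = 1 gives sums and y = 0 gives
  scalar multiples.\<close>

lemma log_intertwining_operator_linear_combination:
  assumes "sl2_vertex_module W1" "sl2_vertex_module W2" "sl2_vertex_module W3"
    and "log_intertwining_operator W1 W2 W3 F" "log_intertwining_operator W1 W2 W3 G"
  shows "log_intertwining_operator W1 W2 W3 (op_scale W3 x F + op_scale W3 y G)"
    (is "log_intertwining_operator W1 W2 W3 ?H")
proof -
  interpret F: sl2_intertwining_operator W1 W2 W3 F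
    using assms by (simp add: sl2_intertwining_operator_def)
  interpret G: sl2_intertwining_operator W1 W2 W3 G
    using assms by (simp add: sl2_intertwining_operator_def)
  let ?s = "mscale W3"
  have H: "?H w1 w2 n k = ?s x (F w1 w2 n k) + ?s y (G w1 w2 n k)" for w1 w2 n k
    by (simp add: op_scale_def)
  show ?thesis
  proof
    fix w1 w2
    have "{k. ?H w1 w2 n k \<noteq> 0} \<subseteq> {k. F w1 w2 n k \<noteq> 0} \<union> {k. G w1 w2 n k \<noteq> 0}" for n
      by (auto simp: op_scale_def)
    then show "log_series (?H w1 w2)"
      using F.log_series G.log_series unfolding log_series_def by (meson finite_UnI finite_subset)
  next
    fix k
    show "bilinear_ser (mscale W1) (mscale W2) ?s (\<lambda>w1 w2 n. ?H w1 w2 n k)"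
      using F.bilinear[of k] G.bilinear[of k]
      by (simp add: op_scale_def bilinear_ser_def Vector_Spaces.linear_iff F.S.scale_right_distrib mult.commute)
  next
    fix w1 w2 n
    obtain M :: nat where M: "\<And>m k. m \<ge> M \<Longrightarrow> mode (F w1 w2) (n + of_nat m) k = 0"
      using F.truncation by blast
    obtain N :: nat where N: "\<And>m k. m \<ge> N \<Longrightarrow> mode (G w1 w2) (n + of_nat m) k = 0"
      using G.truncation by blast
    have "\<forall>m\<ge>max M N. \<forall>k. mode (?H w1 w2) (n + of_nat m) k = 0"
      using M N by (simp add: mode_def op_scale_def)
    then show "\<exists>M::nat. \<forall>m\<ge>M. \<forall>k. mode (?H w1 w2) (n + of_nat m) k = 0" by blast
  next
    fix k
    show "jacobi_identity ?s (mY W1) (mY W2) (mY W3) (\<lambda>w1 w2 n. ?H w1 w2 n k)"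
      unfolding jacobi_identity_iff[OF F.W3.vs] H
    proof (intro allI)
      fix v w1 w2 a b and c :: complex
      obtain K where K: "\<And>m k. m > K \<Longrightarrow> F w1 w2 (c - of_nat m) k = 0"
        using truncated_logE[OF F.truncated_log_I, where n=c] by blast
      obtain K' where K': "\<And>m k. m > K' \<Longrightarrow> G w1 w2 (c - of_nat m) k = 0"
        using truncated_logE[OF G.truncated_log_I, where n=c] by blast
      obtain K1 where K1: "\<And>i. i > K1 \<Longrightarrow> mY W1 v w1 (a - int i) = 0" using F.W1.Y_truncated by blast
      obtain K2 where K2: "\<And>i. i > K2 \<Longrightarrow> mY W2 v w2 (b - int i) = 0" using F.W2.Y_truncated by blast
      \<comment> \<open>One bound for both operators, so that their finite Jacobi identities can be
        combined linearly.\<close>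
      define N where "N = max (max K K') (max K1 K2)"
      have NF: "F w1 w2 (c - of_nat m) k = 0" if "m > N" for m k using K that by (simp add: N_def)
      have NG: "G w1 w2 (c - of_nat m) k = 0" if "m > N" for m k using K' that by (simp add: N_def)
      have N1: "mY W1 v w1 (a - int i) = 0" if "i > N" for i using K1 that by (simp add: N_def)
      have N2: "mY W2 v w2 (b - int i) = 0" if "i > N" for i using K2 that by (simp add: N_def)
      have comb: "(\<Sum>i\<le>N. ?s (c i) (?s x (f i) + ?s y (g i))) =
          ?s x (\<Sum>i\<le>N. ?s (c i) (f i)) + ?s y (\<Sum>i\<le>N. ?s (c i) (g i))" for c f g
        by (simp add: F.S.scale_right_distrib sum.distrib F.S.scale_sum_right mult.commute)
      show "Sum_any (\<lambda>i. ?s ((of_int (- a - 1) gchoose i) * (-1) ^ i)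
            (mY W3 v (?s x (F w1 w2 (c - of_nat i) k) + ?s y (G w1 w2 (c - of_nat i) k)) (b + a + 1 + int i))) -
          Sum_any (\<lambda>i. ?s ((-1) powi (a + 1) * ((of_int (- a - 1) gchoose i) * (-1) ^ i))
            (?s x (F w1 (mY W2 v w2 (b - int i)) (c + of_int (a + 1 + int i)) k) +
             ?s y (G w1 (mY W2 v w2 (b - int i)) (c + of_int (a + 1 + int i)) k))) =
          Sum_any (\<lambda>i. ?s ((of_int (b + int i) gchoose i) * (-1) ^ i)
            (?s x (F (mY W1 v w1 (a - int i)) w2 (c + of_int (b + 1 + int i)) k) +
             ?s y (G (mY W1 v w1 (a - int i)) w2 (c + of_int (b + 1 + int i)) k)))"
      proof (subst (1 2 3) Sum_any_eq_sum_atMost[where N=N])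
        show "(\<Sum>i\<le>N. ?s ((of_int (- a - 1) gchoose i) * (-1) ^ i)
            (mY W3 v (?s x (F w1 w2 (c - of_nat i) k) + ?s y (G w1 w2 (c - of_nat i) k)) (b + a + 1 + int i))) -
          (\<Sum>i\<le>N. ?s ((-1) powi (a + 1) * ((of_int (- a - 1) gchoose i) * (-1) ^ i))
            (?s x (F w1 (mY W2 v w2 (b - int i)) (c + of_int (a + 1 + int i)) k) +
             ?s y (G w1 (mY W2 v w2 (b - int i)) (c + of_int (a + 1 + int i)) k))) =
          (\<Sum>i\<le>N. ?s ((of_int (b + int i) gchoose i) * (-1) ^ i)
            (?s x (F (mY W1 v w1 (a - int i)) w2 (c + of_int (b + 1 + int i)) k) +
             ?s y (G (mY W1 v w1 (a - int i)) w2 (c + of_int (b + 1 + int i)) k)))"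
          by (simp only: module_hom.add[OF F.W3.Y_hom] module_hom.scale[OF F.W3.Y_hom] comb
              F.jacobi_sum[OF NF N2 N1, symmetric] G.jacobi_sum[OF NG N2 N1, symmetric]
              F.S.scale_right_diff_distrib add_diff_add)
      qed (simp_all add: NF NG N1 N2 F.I_zero_left F.I_zero_right G.I_zero_left G.I_zero_right
          module_hom.zero[OF F.W3.Y_hom])
    qed
  next
    fix w1 w2
    show "?H (mL W1 (-1) w1) w2 = ddx_log ?s (?H w1 w2)"
      by (intro ext) (simp add: op_scale_def F.derivative G.derivative ddx_log_def F.S.scale_right_distrib mult.commute)
  next
    fix k
    have "module_hom ?s ?s (mL W3 j)" if "j \<in> {-1, 0, 1}" for j
      using F.W3.sl2 that by (auto simp: sl2_action_def module_hom_iff_linear)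
    then show "sl2_bracket ?s (mL W1) (mL W2) (mL W3) (\<lambda>w1 w2 n. ?H w1 w2 n k)"
      unfolding H by (rule sl2_bracket_linear[OF F.W3.vs _ F.bracket G.bracket])
  qed
qed

lemma Omega_linear_combination:
  assumes "sl2_vertex_module W1" "sl2_vertex_module W2" "sl2_vertex_module W3"
    and "log_intertwining_operator W1 W2 W3 F" "log_intertwining_operator W1 W2 W3 G"
  shows "Omega W3 r (op_scale W3 x F + op_scale W3 y G) =
    op_scale W3 x (Omega W3 r F) + op_scale W3 y (Omega W3 r G)"
proof -
  interpret F: skew_intertwining_operator W1 W2 W3 F r
    using assms by (simp add: sl2_intertwining_operator_def skew_intertwining_operator_def)
  interpret G: skew_intertwining_operator W1 W2 W3 G r
    using assms by (simp add: sl2_intertwining_operator_def skew_intertwining_operator_def)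
  let ?s = "mscale W3"
  have scaled: "log_series (\<lambda>n k. ?s x (f n k))" if "log_series f" for f x
    using that unfolding log_series_def by (metis (mono_tags, lifting) Collect_mono F.S.scale_zero_right finite_subset)
  have H: "(op_scale W3 x F + op_scale W3 y G) w1 w2 = (\<lambda>n k. ?s x (F w1 w2 n k) + ?s y (G w1 w2 n k))" for w1 w2
    by (intro ext) (simp add: op_scale_def)
  have "subst_exp ?s (zeta r) ((op_scale W3 x F + op_scale W3 y G) w1 w2) n k =
      ?s x (F.J w1 w2 n k) + ?s y (G.J w1 w2 n k)" for w1 w2 n k
    unfolding H F.J_def G.J_def
    by (simp add: subst_exp_add[OF F.W3.vs] subst_exp_scale[OF F.W3.vs] scaled F.log_series G.log_series)
  then have "Omega W3 r (op_scale W3 x F + op_scale W3 y G) w2 w1 n k =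
      ?s x (Omega W3 r F w2 w1 n k) + ?s y (Omega W3 r G w2 w1 n k)" for w2 w1 n k
    using F.S.truncated_hom[OF F.truncated_J F.S.scale_comp_hom[OF F.S.id_hom]]
      F.S.truncated_hom[OF G.truncated_J F.S.scale_comp_hom[OF F.S.id_hom]]
    by (simp add: Omega_eq_exp_xD[of _ _ "op_scale W3 x F + op_scale W3 y G"] F.S.exp_xD_eq F.Omega_eq G.Omega_eq
        F.S.exp_ser_add F.S.exp_ser_scale F.truncated_J G.truncated_J)
  then show ?thesis by (intro ext) (simp add: op_scale_def)
qed

lemma subspace_intertwining_space:
  fixes W1 :: "('v, 'w1::ab_group_add) gmod" and W2 :: "('v, 'w2::ab_group_add) gmod"
    and W3 :: "('v, 'w3::ab_group_add) gmod"
  assumes "sl2_vertex_module W1" "sl2_vertex_module W2" "sl2_vertex_module W3"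
    and sub: "\<And>\<beta>. module.subspace (mscale W3) (H3 \<beta>)"
  shows "module.subspace (op_scale W3) (intertwining_space W1 W2 W3 H1 H2 H3)"
proof -
  interpret W3: sl2_vertex_module W3 by fact
  interpret S: vector_space "mscale W3" by (rule W3.vs)
  interpret O: vector_space "op_scale W3 :: complex \<Rightarrow> ('w1, 'w2, 'w3) log_op \<Rightarrow> _"
    by (rule vector_space_op_scale) (rule W3.vs)
  let ?X = "intertwining_space W1 W2 W3 H1 H2 H3"
  have comb: "op_scale W3 x F + op_scale W3 y G \<in> ?X" if "F \<in> ?X" "G \<in> ?X" for x y F G
    using that log_intertwining_operator_linear_combination[OF assms(1-3)]
    by (auto simp: intertwining_space_def grading_compatible_def mode_def op_scale_def
        intro!: S.subspace_add[OF sub] S.subspace_scale[OF sub])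
  show ?thesis
    unfolding O.subspace_def
  proof (intro conjI ballI allI)
    show "0 \<in> ?X"
      using log_intertwining_operator_0[OF assms(1-3)]
      by (simp add: intertwining_space_def grading_compatible_def mode_def S.subspace_0[OF sub])
    show "F + G \<in> ?X" if "F \<in> ?X" "G \<in> ?X" for F G using comb[OF that, of 1 1] by simp
    show "op_scale W3 x F \<in> ?X" if "F \<in> ?X" for x F using comb[OF that that, of x 0] by simp
  qed
qed

section \<open>The correspondence as a linear isomorphism\<close>

lemma Omega_skew_symmetry:
  assumes "sl2_vertex_module W1" "sl2_vertex_module W2" "sl2_vertex_module W3"
    and "log_intertwining_operator W1 W2 W3 I"
  shows "log_intertwining_operator W2 W1 W3 (Omega W3 r I)"
    and "Omega W3 (- r - 1) (Omega W3 r I) = I"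
    and "Omega W3 r (Omega W3 (- r - 1) I) = I"
proof -
  have skew: "skew_intertwining_operator W1 W2 W3 I"
    using assms by (simp add: sl2_intertwining_operator_def skew_intertwining_operator_def)
  show "log_intertwining_operator W2 W1 W3 (Omega W3 r I)"
    using skew by (rule skew_intertwining_operator.log_intertwining_operator_Omega)
  show "Omega W3 (- r - 1) (Omega W3 r I) = I"
    using skew by (rule skew_intertwining_operator.Omega_Omega)
  show "Omega W3 r (Omega W3 (- r - 1) I) = I"
    \<comment> \<open>The map r -> -r - 1 is an involution.\<close>
    using skew_intertwining_operator.Omega_Omega[OF skew, of "- r - 1"] by simp
qed

lemma linear_iso_on_Omega:
  fixes H1 :: "'g::ab_group_add \<Rightarrow> 'w1::ab_group_add set" and H2 :: "'g \<Rightarrow> 'w2::ab_group_add set"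
    and H3 :: "'g \<Rightarrow> 'w3::ab_group_add set"
  assumes mod: "sl2_vertex_module W1" "sl2_vertex_module W2" "sl2_vertex_module W3"
    and sub: "\<And>\<beta>. module.subspace (mscale W3) (H3 \<beta>)"
    and D: "\<And>\<beta> w. w \<in> H3 \<beta> \<Longrightarrow> mL W3 (-1) w \<in> H3 \<beta>"
  shows "linear_iso_on (op_scale W3) (op_scale W3)
    (intertwining_space W1 W2 W3 H1 H2 H3) (intertwining_space W2 W1 W3 H2 H1 H3) (Omega W3 r)"
proof -
  have vs: "vector_space (mscale W3)" using mod(3) by (rule sl2_vertex_module.vs)
  interpret A: vector_space "op_scale W3 :: complex \<Rightarrow> ('w1, 'w2, 'w3) log_op \<Rightarrow> _"
    by (rule vector_space_op_scale) (rule vs)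
  interpret B: vector_space "op_scale W3 :: complex \<Rightarrow> ('w2, 'w1, 'w3) log_op \<Rightarrow> _"
    by (rule vector_space_op_scale) (rule vs)
  let ?X = "intertwining_space W1 W2 W3 H1 H2 H3" and ?X' = "intertwining_space W2 W1 W3 H2 H1 H3"
  have to: "Omega W3 r' F \<in> ?X'" if "F \<in> ?X" for F r'
    using that Omega_skew_symmetry(1)[OF mod]
    by (simp add: intertwining_space_def grading_compatible_Omega[where ?H3.0=H3, OF vs sub D])
  have fro: "Omega W3 r' F \<in> ?X" if "F \<in> ?X'" for F r'
    using that Omega_skew_symmetry(1)[OF mod(2,1,3)]
    by (simp add: intertwining_space_def grading_compatible_Omega[where ?H3.0=H3, OF vs sub D])
  have lin: "Omega W3 r (op_scale W3 x F + op_scale W3 y G) =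
      op_scale W3 x (Omega W3 r F) + op_scale W3 y (Omega W3 r G)" if "F \<in> ?X" "G \<in> ?X" for F G x y
    using Omega_linear_combination[OF mod] that by (simp add: intertwining_space_def)
  have "bij_betw (Omega W3 r) ?X ?X'"
    \<comment> \<open>The inverse has index -r - 1; that it is also a right inverse is the third
      identity with \<open>W1\<close> and \<open>W2\<close> exchanged.\<close>
    using to fro Omega_skew_symmetry(2)[OF mod] Omega_skew_symmetry(3)[OF mod(2,1,3)]
    by (intro bij_betwI[where g="Omega W3 (- r - 1)"]) (auto simp: intertwining_space_def)
  moreover have "Omega W3 r (F + G) = Omega W3 r F + Omega W3 r G" if "F \<in> ?X" "G \<in> ?X" for F G
    using lin[OF that, of 1 1] by simp
  moreover have "Omega W3 r (op_scale W3 x F) = op_scale W3 x (Omega W3 r F)" if "F \<in> ?X" for F x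
    using lin[OF that that, of x 0] by simp
  ultimately show ?thesis
    by (simp add: linear_iso_on_def subspace_intertwining_space[where ?H3.0=H3, OF mod sub]
        subspace_intertwining_space[where ?H3.0=H3, OF mod(2,1,3) sub])
qed


theorem proposition3p44:
  fixes V :: "'v::ab_group_add va"
    and W1 :: "('v, 'w1::ab_group_add) gmod"
    and W2 :: "('v, 'w2::ab_group_add) gmod"
    and W3 :: "('v, 'w3::ab_group_add) gmod"
    and r :: int
    and A :: "'g::ab_group_add set"
    and G :: "'g \<Rightarrow> 'v set"
    and H1 :: "'g \<Rightarrow> 'w1 set"
    and H2 :: "'g \<Rightarrow> 'w2 set"
    and H3 :: "'g \<Rightarrow> 'w3 set"
  assumes "vertex_algebra V"
    and "generalized_module V W1"
    and "generalized_module V W2"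
    and "generalized_module V W3"
  shows
    "(\<forall>I. log_intertwining_operator W1 W2 W3 I \<longrightarrow>
          log_intertwining_operator W2 W1 W3 (Omega W3 r I) \<and>
          Omega W3 (- r - 1) (Omega W3 r I) = I \<and>
          Omega W3 r (Omega W3 (- r - 1) I) = I) \<and>
     (add_subgroup A \<and>
      strongly_graded_algebra V A G \<and>
      strongly_graded_module A G W1 H1 \<and>
      strongly_graded_module A G W2 H2 \<and>
      strongly_graded_module A G W3 H3 \<longrightarrow>
        (\<forall>I. log_intertwining_operator W1 W2 W3 I \<and> grading_compatible H1 H2 H3 I \<longrightarrow>
             grading_compatible H2 H1 H3 (Omega W3 r I)) \<and>
        linear_iso_on (op_scale W3) (op_scale W3)
          (intertwining_space W1 W2 W3 H1 H2 H3)
          (intertwining_space W2 W1 W3 H2 H1 H3)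
          (Omega W3 r) \<and>
        fusion_rule W1 W2 W3 H1 H2 H3 =o fusion_rule W2 W1 W3 H2 H1 H3)"
proof -
  have mod: "sl2_vertex_module W1" "sl2_vertex_module W2" "sl2_vertex_module W3"
    using generalized_module_imp_sl2_vertex_module assms by blast+
  have vs: "vector_space (mscale W3)" using mod(3) by (rule sl2_vertex_module.vs)
  have graded: "(\<forall>I. log_intertwining_operator W1 W2 W3 I \<and> grading_compatible H1 H2 H3 I \<longrightarrow>
        grading_compatible H2 H1 H3 (Omega W3 r I)) \<and>
      linear_iso_on (op_scale W3) (op_scale W3)
        (intertwining_space W1 W2 W3 H1 H2 H3) (intertwining_space W2 W1 W3 H2 H1 H3) (Omega W3 r) \<and>
      fusion_rule W1 W2 W3 H1 H2 H3 =o fusion_rule W2 W1 W3 H2 H1 H3"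
    if "strongly_graded_module A G W3 H3"
  proof -
    interpret H3: strongly_graded_module A G W3 H3 by (rule that)
    have sub: "module.subspace (mscale W3) (H3 \<beta>)" for \<beta>
      using H3.decomposition by (simp add: direct_sum_def)
    have D: "mL W3 (-1) w \<in> H3 \<beta>" if "w \<in> H3 \<beta>" for \<beta> w
      using H3.sl2 that by simp
    have iso: "linear_iso_on (op_scale W3) (op_scale W3)
        (intertwining_space W1 W2 W3 H1 H2 H3) (intertwining_space W2 W1 W3 H2 H1 H3) (Omega W3 r)"
      by (rule linear_iso_on_Omega[OF mod sub D])
    then show ?thesis
      using linear_iso_on_imp_card_dim_ordIso[OF vector_space_op_scale[OF vs] vector_space_op_scale[OF vs] iso]
      by (simp add: fusion_rule_def grading_compatible_Omega[where ?H3.0=H3, OF vs sub D])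
  qed
  show ?thesis
    using Omega_skew_symmetry[OF mod] graded by blast
qed

end
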